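(* Let $\sigma>0$ and $\delta>0$. For each integer $N\ge 2$ let $x(t)=(x_1(t),\ldots,x_N(t))$, $t\ge 0$, be the system of $N$ Brownian particles with diffusion coefficient $\sigma$ and pairwise synchronizing jumps at the epochs of a Poisson flow of intensity $\delta$ (defined in the context), and let $R_N(t)=\mathsf{E}\,V(x(t))$. Then there exists a number $\varkappa>0$ such that for all $N\ge 2$ and all $t\ge 0$ $$R_N(t)=\sigma^2\delta^{-1}\,l_N\left(1-\exp\left(-\delta t/l_N\right)\right)+\exp\left(-\delta t/l_N\right)R_N(0),$$ where $l_N=N(N-1)/\varkappa$.
   Context: Definition of the process. Fix $N\ge 2$ and $\mathcal{N}_N=\{1,\ldots,N\}$. On a probability space let the following be given: (a) a standard $N$-dimensional Brownian motion $B(t)=(B_1(t),\ldots,B_N(t))$; (b) random times $0=\tau_0<\tau_1<\tau_2<\cdots$ such that the increments $\tau_n-\tau_{n-1}$, $n\ge 1$, are independent and exponentially distributed, $\mathsf{P}(\tau_n-\tau_{n-1}>s)=\exp(-\delta s)$ (epochs of a Poisson flow of intensity $\delta$); (c) a random initial configuration $x(0)=(x_1(0),\ldots,x_N(0))\in\mathbb{R}^N$; (d) a sequence $(i_1,j_1),(i_2,j_2),\ldots$ of independent random ordered pairs, each uniformly distributed over the ordered pairs $(i,j)$ with $i,j\in\mathcal{N}_N$, $i\ne j$. The objects in (a), (b), (c), (d) are mutually independent. The process $x(t)$ has right-continuous trajectories and satisfies: - free motion: for all $n\ge 0$, $s\in[\tau_n,\tau_{n+1})$ and $k\in\mathcal{N}_N$,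 $x_k(s)-x_k(\tau_n)=\sigma\,(B_k(s)-B_k(\tau_n))$; - synchronizing jumps: for all $n\ge 1$, $x_{j_n}(\tau_n)=x_{i_n}(\tau_n-0)$ and $x_m(\tau_n)=x_m(\tau_n-0)$ for all $m\in\mathcal{N}_N\setminus\{j_n\}$. For $x\in\mathbb{R}^N$ put $M(x)=\frac1N\sum_{m=1}^N x_m$ and $V(x)=\frac{1}{N-1}\sum_{m=1}^N (x_m-M(x))^2$. Finally $R_N(t)=\mathsf{E}\,V(x(t))$. *)

theory Defs
  imports "HOL-Probability.Probability"
begin

text \<open>Configurations in \<open>\<real>\<^sup>N\<close> are functions \<^typ>\<open>nat \<Rightarrow> real\<close>, of which only the
  values on \<open>{1..N}\<close> matter.\<close>

definition emp_mean :: "nat \<Rightarrow> (nat \<Rightarrow> real) \<Rightarrow> real" where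
  "emp_mean N y = (\<Sum>m=1..N. y m) / real N"

definition emp_var :: "nat \<Rightarrow> (nat \<Rightarrow> real) \<Rightarrow> real" where
  "emp_var N y = (\<Sum>m=1..N. (y m - emp_mean N y)\<^sup>2) / (real N - 1)"

definition generated_events :: "'a measure \<Rightarrow> 'i set \<Rightarrow> 'b measure \<Rightarrow> ('i \<Rightarrow> 'a \<Rightarrow> 'b) \<Rightarrow> 'a set set"
  where "generated_events M I S X =
    sets (vimage_algebra (space M) (\<lambda>\<omega>. \<lambda>i\<in>I. X i \<omega>) (\<Pi>\<^sub>M i\<in>I. S))"

context prob_space
begin

definition standard_brownian_motion :: "(real \<Rightarrow> 'a \<Rightarrow> real) \<Rightarrow> bool" where
  "standard_brownian_motion W \<longleftrightarrow>
     (\<forall>t\<ge>0. random_variable borel (W t)) \<and>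
     (AE \<omega> in M. W 0 \<omega> = 0) \<and>
     (\<forall>(t :: nat \<Rightarrow> real) n. 0 \<le> t 0 \<and> mono t \<longrightarrow>
        indep_vars (\<lambda>_. borel) (\<lambda>i \<omega>. W (t (Suc i)) \<omega> - W (t i) \<omega>) {..<n}) \<and>
     (\<forall>s t. 0 \<le> s \<and> s < t \<longrightarrow>
        distributed M lborel (\<lambda>\<omega>. W t \<omega> - W s \<omega>) (normal_density 0 (sqrt (t - s)))) \<and>
     (AE \<omega> in M. continuous_on {0..} (\<lambda>t. W t \<omega>))"

definition standard_brownian_motion_dim :: "nat \<Rightarrow> (nat \<Rightarrow> real \<Rightarrow> 'a \<Rightarrow> real) \<Rightarrow> bool" where
  "standard_brownian_motion_dim N B \<longleftrightarrow>
     (\<forall>k\<in>{1..N}. standard_brownian_motion (B k)) \<and>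
     indep_vars (\<lambda>_. \<Pi>\<^sub>M t\<in>{0..}. borel) (\<lambda>k \<omega>. \<lambda>t\<in>{0..}. B k t \<omega>) {1..N}"

definition poisson_epochs :: "real \<Rightarrow> (nat \<Rightarrow> 'a \<Rightarrow> real) \<Rightarrow> bool" where
  "poisson_epochs \<delta> \<tau> \<longleftrightarrow>
     (\<forall>n. random_variable borel (\<tau> n)) \<and>
     (AE \<omega> in M. \<tau> 0 \<omega> = 0 \<and> (\<forall>n. \<tau> n \<omega> < \<tau> (Suc n) \<omega>)) \<and>
     indep_vars (\<lambda>_. borel) (\<lambda>n \<omega>. \<tau> (Suc n) \<omega> - \<tau> n \<omega>) UNIV \<and>
     (\<forall>n. distributed M lborel (\<lambda>\<omega>. \<tau> (Suc n) \<omega> - \<tau> n \<omega>) (exponential_density \<delta>))"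

definition uniform_pair_sequence :: "nat \<Rightarrow> (nat \<Rightarrow> 'a \<Rightarrow> nat \<times> nat) \<Rightarrow> bool" where
  "uniform_pair_sequence N p \<longleftrightarrow>
     indep_vars (\<lambda>_. count_space UNIV) p {1..} \<and>
     (\<forall>n\<ge>1. distr M (count_space UNIV) (p n) =
        measure_pmf (pmf_of_set {(i, j). i \<in> {1..N} \<and> j \<in> {1..N} \<and> i \<noteq> j}))"

end

datatype source = Noise | Epochs | Initial | Pairs

text \<open>\<open>x t \<omega> k\<close> is the position of particle \<open>k\<close> at time \<open>t\<close>, and \<open>p n \<omega>\<close> is the pair
  \<open>(i\<^sub>n, j\<^sub>n)\<close>, used for \<open>n \<ge> 1\<close> only. Pathwise requirements are imposed almost surely.
  In \<open>jump_copy\<close> and \<open>jump_stay\<close> the left limits \<open>x(\<tau>\<^sub>n - 0)\<close> are expressed through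
  \<^term>\<open>at_left\<close>.\<close>

locale synchronizing_particles = prob_space M for M :: "'a measure" +
  fixes N :: nat
    and \<sigma> \<delta> :: real
    and B :: "nat \<Rightarrow> real \<Rightarrow> 'a \<Rightarrow> real"
    and \<tau> :: "nat \<Rightarrow> 'a \<Rightarrow> real"
    and p :: "nat \<Rightarrow> 'a \<Rightarrow> nat \<times> nat"
    and x :: "real \<Rightarrow> 'a \<Rightarrow> nat \<Rightarrow> real"
  assumes brownian: "standard_brownian_motion_dim N B"
    and epochs: "poisson_epochs \<delta> \<tau>"
    and pairs: "uniform_pair_sequence N p"
    and x_measurable: "\<And>t k. 0 \<le> t \<Longrightarrow> k \<in> {1..N} \<Longrightarrow> random_variable borel (\<lambda>\<omega>. x t \<omega> k)"
    and independent: "indep_sets (\<lambda>s. case s of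
          Noise \<Rightarrow> generated_events M ({1..N} \<times> {0..}) borel (\<lambda>(k, t). B k t)
        | Epochs \<Rightarrow> generated_events M UNIV borel \<tau>
        | Initial \<Rightarrow> generated_events M {1..N} borel (\<lambda>k \<omega>. x 0 \<omega> k)
        | Pairs \<Rightarrow> generated_events M {1..} (count_space UNIV) p) UNIV"
    and right_continuous: "AE \<omega> in M. \<forall>t\<ge>0. \<forall>k\<in>{1..N}. continuous (at_right t) (\<lambda>s. x s \<omega> k)"
    and free_motion: "AE \<omega> in M. \<forall>n. \<forall>s\<in>{\<tau> n \<omega>..<\<tau> (Suc n) \<omega>}. \<forall>k\<in>{1..N}.
          x s \<omega> k - x (\<tau> n \<omega>) \<omega> k = \<sigma> * (B k s \<omega> - B k (\<tau> n \<omega>) \<omega>)"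
    and jump_copy: "AE \<omega> in M. \<forall>n\<ge>1.
          ((\<lambda>s. x s \<omega> (fst (p n \<omega>))) \<longlongrightarrow> x (\<tau> n \<omega>) \<omega> (snd (p n \<omega>))) (at_left (\<tau> n \<omega>))"
    and jump_stay: "AE \<omega> in M. \<forall>n\<ge>1. \<forall>m\<in>{1..N} - {snd (p n \<omega>)}.
          ((\<lambda>s. x s \<omega> m) \<longlongrightarrow> x (\<tau> n \<omega>) \<omega> m) (at_left (\<tau> n \<omega>))"

text \<open>The expectation of the nonnegative variable \<open>V(x(t))\<close> is taken in \<open>[0,\<infinity>]\<close>, because the
  initial configuration is arbitrary and its empirical variance need not be integrable.\<close>

definition mean_emp_var :: "'a measure \<Rightarrow> nat \<Rightarrow> (real \<Rightarrow> 'a \<Rightarrow> nat \<Rightarrow> real) \<Rightarrow> real \<Rightarrow> ennreal" where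
  "mean_emp_var M N x t = (\<integral>\<^sup>+ \<omega>. ennreal (emp_var N (x t \<omega>)) \<partial>M)"

end

theory Submission
  imports Defs "HOL-Real_Asymp.Real_Asymp"
begin

text \<open>
  Since \<open>V(x) = \<Sum>\<^sub>a\<^sub>,\<^sub>b (x\<^sub>a - x\<^sub>b)\<^sup>2 / (2N(N - 1))\<close>, copying along a uniformly chosen pair multiplies the mean of
  \<open>V\<close> by \<open>r = 1 - 2 / (N(N - 1)) = 1 - 1 / l\<close>, while free motion during a time \<open>h\<close> adds \<open>\<sigma>\<^sup>2 h\<close>; so
  \<open>\<kappa> = 2\<close>. By independence the sources can be placed on separate sample points and averaged one
  after the other: the Brownian motion at fixed epochs, where only the orthogonality of its
  increments matters, then the pairs, then the initial configuration. There remains an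
  expectation over the epochs, affine in \<open>R\<^sub>N(0)\<close>. It is computed for finite \<open>R\<^sub>N(0)\<close> by telescoping:
  the claimed right-hand side \<open>W(v, t)\<close> solves the renewal equation, so that
  \<open>E[W(V\<^sub>n, t - \<tau>\<^sub>n); \<tau>\<^sub>n \<le> t]\<close> decreases from step \<open>n\<close> to step \<open>n + 1\<close> by the contribution of \<open>\<tau>\<^sub>n \<le> t < \<tau>\<^sub>n\<^sub>+\<^sub>1\<close>.
  As both sides are affine in \<open>R\<^sub>N(0)\<close>, this also covers \<open>R\<^sub>N(0) = \<infinity>\<close>.
\<close>

subsection \<open>Copying chains\<close>

text \<open>Between epochs the mean of V grows at rate \<open>\<sigma>\<^sup>2\<close>, and epochs
  arriving at rate \<delta> each remove the fraction \<open>1 / l\<close> of it, so the formula to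
  be proved is the solution of R' = \<open>\<sigma>\<^sup>2\<close> - \<delta> R / l. The renewal
  equation takes the place of this differential equation, whose use would first require
  differentiability of R.

  For a fixed sequence of pairs V alone obeys no recursion, because a copying step mixes the squared
  distances of different particles. The noise is therefore averaged for the whole table of squared
  distances; a recursion for a single number appears only once the pairs are averaged as well.

  Two obstacles shape the rest. Brownian paths are continuous only almost surely, yet they are
  evaluated at random epochs that Tonelli's theorem is to freeze, which calls for a jointly
  measurable version. And an infinite mean at time 0 forbids subtraction, so the two nonnegative
  coefficients of the affine formula are read off from the initial values 0 and 1.\<close>

definition copy_index :: "nat \<Rightarrow> nat \<times> nat \<Rightarrow> nat \<Rightarrow> nat" where
  "copy_index N q a = (if a = snd q \<and> fst q \<in> {1..N} then fst q else a)"

text \<open>\<open>chain\<close> is the configuration just after the \<open>n\<close>-th epoch, when \<open>\<xi> i k\<close> is the Brownian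
  increment of particle \<open>k\<close> between epochs \<open>i\<close> and \<open>i + 1\<close>; adding \<open>\<sigma> * \<xi> n a\<close> to it gives the
  configuration at the end of the \<open>n\<close>-th free flight.\<close>

primrec chain :: "nat \<Rightarrow> real \<Rightarrow> (nat \<Rightarrow> nat \<times> nat) \<Rightarrow> (nat \<Rightarrow> real) \<Rightarrow> (nat \<Rightarrow> nat \<Rightarrow> real)
    \<Rightarrow> nat \<Rightarrow> nat \<Rightarrow> real" where
  "chain N \<sigma> \<pi> y \<xi> 0 a = y a"
| "chain N \<sigma> \<pi> y \<xi> (Suc n) a =
     (let a' = copy_index N (\<pi> (Suc n)) a in chain N \<sigma> \<pi> y \<xi> n a' + \<sigma> * \<xi> n a')"

text \<open>Independent displacements of variance \<open>\<sigma>\<^sup>2 * s\<close> add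
  \<open>2 * \<sigma>\<^sup>2 * s\<close> to the mean squared distance of two different particles,
  and nothing if both indices name the same particle.\<close>

definition spread_step :: "real \<Rightarrow> real \<Rightarrow> (nat \<Rightarrow> nat \<Rightarrow> real) \<Rightarrow> nat \<Rightarrow> nat \<Rightarrow> real" where
  "spread_step \<sigma> s D a b = D a b + (if a = b then 0 else 2 * \<sigma>\<^sup>2 * s)"

text \<open>The conditional mean of the squared distance of particles \<open>a\<close> and \<open>b\<close>, given the pairs, the
  initial configuration and the durations \<open>h\<close> of the free flights.\<close>

primrec gap :: "nat \<Rightarrow> real \<Rightarrow> (nat \<Rightarrow> nat \<times> nat) \<Rightarrow> (nat \<Rightarrow> real) \<Rightarrow> (nat \<Rightarrow> real)
    \<Rightarrow> nat \<Rightarrow> nat \<Rightarrow> nat \<Rightarrow> real" where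
  "gap N \<sigma> \<pi> y h 0 a b = (y a - y b)\<^sup>2"
| "gap N \<sigma> \<pi> y h (Suc n) a b =
     spread_step \<sigma> (h n) (gap N \<sigma> \<pi> y h n) (copy_index N (\<pi> (Suc n)) a) (copy_index N (\<pi> (Suc n)) b)"

text \<open>The conditional mean of \<open>V\<close> just after the \<open>n\<close>-th epoch, averaged also over the pairs, with \<open>r = 1 - 2 / (N (N - 1))\<close>.\<close>

primrec post :: "real \<Rightarrow> real \<Rightarrow> real \<Rightarrow> (nat \<Rightarrow> real) \<Rightarrow> nat \<Rightarrow> real" where
  "post r \<sigma> v h 0 = v"
| "post r \<sigma> v h (Suc n) = r * (post r \<sigma> v h n + \<sigma>\<^sup>2 * h n)"

text \<open>A linear functional of the table \<open>D\<close>, hence compatible with expectations;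
  its value at the table of squared distances is V.\<close>

definition half_mean :: "nat \<Rightarrow> (nat \<Rightarrow> nat \<Rightarrow> real) \<Rightarrow> real" where
  "half_mean N D = (\<Sum>a=1..N. \<Sum>b=1..N. D a b) / (2 * real N * (real N - 1))"

text \<open>Expanded, both sides become the same combination of the power sums \<open>S\<close> and
  \<open>Q\<close>. The pairwise form no longer contains the sample mean, so that copying merely
  substitutes indices.\<close>

lemma emp_var_eq_half_mean:
  assumes "N \<ge> 2"
  shows "emp_var N y = half_mean N (\<lambda>a b. (y a - y b)\<^sup>2)"
proof -
  define S Q where "S = (\<Sum>a=1..N. y a)" and "Q = (\<Sum>a=1..N. (y a)\<^sup>2)"
  have N: "real N > 0" "real N - 1 > 0" using assms by auto
  have "(\<Sum>a=1..N. \<Sum>b=1..N. (y a - y b)\<^sup>2) = (\<Sum>a=1..N. \<Sum>b=1..N. (y a)\<^sup>2 + (y b)\<^sup>2 - 2 * y a * y b)"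
    by (simp add: power2_diff)
  also have "\<dots> = (\<Sum>a=1..N. real N * (y a)\<^sup>2 + Q - 2 * y a * S)"
    by (simp add: sum.distrib sum_subtractf Q_def S_def sum_distrib_left)
  also have "\<dots> = 2 * real N * Q - 2 * S\<^sup>2"
    by (simp add: sum.distrib sum_subtractf Q_def S_def flip: sum_distrib_left sum_distrib_right)
      (simp add: power2_eq_square)
  finally have 1: "(\<Sum>a=1..N. \<Sum>b=1..N. (y a - y b)\<^sup>2) = 2 * real N * Q - 2 * S\<^sup>2" .
  have "(\<Sum>m=1..N. (y m - S / N)\<^sup>2) = (\<Sum>m=1..N. (y m)\<^sup>2 - 2 * (S/N) * y m + (S/N)\<^sup>2)"
    by (simp add: power2_diff algebra_simps)
  also have "\<dots> = Q - 2 * (S/N) * S + N * (S/N)\<^sup>2"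
    by (simp add: sum.distrib sum_subtractf Q_def S_def flip: sum_distrib_left sum_divide_distrib)
  also have "\<dots> = (2 * real N * Q - 2 * S\<^sup>2) / (2 * N)"
    using N by (simp add: field_simps power2_eq_square)
  finally show ?thesis
    unfolding emp_var_def half_mean_def emp_mean_def 1 S_def[symmetric] by simp
qed

lemma half_mean_nonneg:
  "(\<And>a b. a \<in> {1..N} \<Longrightarrow> b \<in> {1..N} \<Longrightarrow> 0 \<le> D a b) \<Longrightarrow> N \<ge> 2 \<Longrightarrow> 0 \<le> half_mean N D"
  unfolding half_mean_def by (intro divide_nonneg_nonneg sum_nonneg) auto

text \<open>Each of the N(N - 1) off-diagonal entries gains \<open>2 * \<sigma>\<^sup>2 * s\<close>,
  and the normalization divides by 2N(N - 1).\<close>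

lemma half_mean_spread_step:
  assumes "N \<ge> 2"
  shows "half_mean N (spread_step \<sigma> s D) = half_mean N D + \<sigma>\<^sup>2 * s"
proof -
  have "(\<Sum>a=1..N. \<Sum>b=1..N. spread_step \<sigma> s D a b)
      = (\<Sum>a=1..N. \<Sum>b=1..N. D a b + 2 * \<sigma>\<^sup>2 * s - (if b = a then 2 * \<sigma>\<^sup>2 * s else 0))"
    by (intro sum.cong) (auto simp: spread_step_def)
  also have "\<dots> = (\<Sum>a=1..N. \<Sum>b=1..N. D a b) + 2 * real N * (real N - 1) * (\<sigma>\<^sup>2 * s)"
    by (simp add: sum.distrib sum_subtractf algebra_simps)
  finally show ?thesis using assms by (simp add: half_mean_def add_divide_distrib)
qed

section \<open>The average effect of one copying step\<close>

definition index_pairs :: "nat \<Rightarrow> (nat \<times> nat) set" where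
  "index_pairs N = {(i, j). i \<in> {1..N} \<and> j \<in> {1..N} \<and> i \<noteq> j}"

lemma index_pairs_eq: "index_pairs N = {1..N} \<times> {1..N} - (\<lambda>i. (i, i)) ` {1..N}"
  by (auto simp: index_pairs_def)

lemma finite_index_pairs: "finite (index_pairs N)"
  by (auto simp: index_pairs_eq)

lemma sum_index_pairs:
  fixes F :: "nat \<Rightarrow> nat \<Rightarrow> real"
  shows "(\<Sum>q\<in>index_pairs N. F (fst q) (snd q)) = (\<Sum>i=1..N. \<Sum>j=1..N. F i j) - (\<Sum>i=1..N. F i i)"
  unfolding index_pairs_eq
  by (subst sum_diff) (auto simp: sum.cartesian_product split_def sum.reindex inj_on_def)

lemma card_index_pairs: "real (card (index_pairs N)) = real N * (real N - 1)"
  using sum_index_pairs[where F = "\<lambda>_ _. 1" and N = N] by (simp add: algebra_simps)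

text \<open>Copying from \<open>i\<close> to \<open>j\<close> loses the term at \<open>j\<close> and
  counts the term at \<open>i\<close> twice.\<close>

lemma sum_copy_index:
  fixes g :: "nat \<Rightarrow> real"
  assumes "i \<in> {1..N}" "j \<in> {1..N}"
  shows "(\<Sum>a=1..N. g (copy_index N (i, j) a)) = (\<Sum>a=1..N. g a) + g i - g j"
proof -
  have "(\<Sum>a=1..N. g (copy_index N (i, j) a)) = (\<Sum>a=1..N. g a + (if a = j then g i - g j else 0))"
    by (intro sum.cong) (use assms in \<open>auto simp: copy_index_def\<close>)
  then show ?thesis using assms by (simp add: sum.distrib)
qed

text \<open>For a single pair, the row and column sums of \<open>D\<close> enter through
  \<open>R i - R j\<close> and \<open>C i - C j\<close>, which cancel in the sum over all ordered
  pairs. What remains is \<open>S\<close> for each pair, less the two cross entries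
  \<open>D i j\<close> and \<open>D j i\<close>: in total (N(N - 1) - 2) S. This 2 is the value of
  \<kappa>.\<close>

lemma sum_half_mean_copy_index:
  assumes "\<And>a. D a a = 0" and N: "N \<ge> 2"
  shows "(\<Sum>q\<in>index_pairs N. half_mean N (\<lambda>a b. D (copy_index N q a) (copy_index N q b)))
    = real N * (real N - 1) * (1 - 2 / (real N * (real N - 1))) * half_mean N D"
proof -
  define S where "S = (\<Sum>a=1..N. \<Sum>b=1..N. D a b)"
  define R C where "R i = (\<Sum>b=1..N. D i b)" and "C i = (\<Sum>a=1..N. D a i)" for i
  have sumR: "(\<Sum>i=1..N. R i) = S" and sumC: "(\<Sum>i=1..N. C i) = S"
    unfolding R_def C_def S_def by (rule refl, rule sum.swap)
  \<comment> \<open>Obtained from \<open>sum_copy_index\<close> in the second index and then in the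
    first, with the zeros \<open>D i i\<close> and \<open>D j j\<close> left out.\<close>
  define F where "F i j = S + R i - R j + (C i - D j i) - (C j + D i j)" for i j
  have F: "(\<Sum>a=1..N. \<Sum>b=1..N. D (copy_index N q a) (copy_index N q b)) = F (fst q) (snd q)"
    if q: "q \<in> index_pairs N" for q
  proof -
    obtain i j where q': "q = (i, j)" "i \<in> {1..N}" "j \<in> {1..N}"
      using q by (auto simp: index_pairs_def)
    have "(\<Sum>a=1..N. \<Sum>b=1..N. D (copy_index N q a) (copy_index N q b))
       = (\<Sum>a=1..N. R (copy_index N q a) + D (copy_index N q a) i - D (copy_index N q a) j)"
      unfolding q'(1) by (subst sum_copy_index[OF q'(2,3)]) (simp add: R_def)
    also have "\<dots> = F i j"
      unfolding q'(1) sum.distrib sum_subtractf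
      by (simp only: sum_copy_index[OF q'(2,3)] sum_copy_index[OF q'(2,3), of "\<lambda>c. D c _"]
          sumR F_def assms C_def[symmetric])
    finally show ?thesis by (simp add: q')
  qed
  have "(\<Sum>q\<in>index_pairs N. F (fst q) (snd q)) = (\<Sum>i=1..N. \<Sum>j=1..N. F i j) - (\<Sum>i=1..N. F i i)"
    by (rule sum_index_pairs)
  also have "(\<Sum>i=1..N. \<Sum>j=1..N. F i j) = (\<Sum>i=1..N. N * S + N * R i - S + (N * C i - C i) - (S + R i))"
    unfolding F_def sum.distrib sum_subtractf
    by (simp add: sumR sumC R_def[symmetric] C_def[symmetric] sum.distrib sum_subtractf sum_negf del: One_nat_def)
  also have "\<dots> = N * N * S - 2 * S"
    by (simp add: sum.distrib sum_subtractf sumR sumC sum_negf del: One_nat_def flip: sum_distrib_left)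
  also have "(\<Sum>i=1..N. F i i) = N * S" by (simp add: F_def assms)
  finally have *: "(\<Sum>q\<in>index_pairs N. F (fst q) (snd q)) = (N * (real N - 1) - 2) * S"
    by (simp add: algebra_simps)
  have "(\<Sum>q\<in>index_pairs N. half_mean N (\<lambda>a b. D (copy_index N q a) (copy_index N q b)))
      = (\<Sum>q\<in>index_pairs N. F (fst q) (snd q)) / (2 * real N * (real N - 1))"
    unfolding half_mean_def sum_divide_distrib[of _ "index_pairs N"]
    by (intro sum.cong refl) (simp only: F)
  also have "\<dots> = real N * (real N - 1) * (1 - 2 / (real N * (real N - 1))) * half_mean N D"
  proof -
    define m where "m = real N * (real N - 1)"
    have "m \<noteq> 0" using N by (simp add: m_def)
    then show ?thesis
      unfolding * half_mean_def S_def[symmetric] mult.assoc[of 2] m_def[symmetric]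
      by (simp add: field_simps)
  qed
  finally show ?thesis .
qed

text \<open>The guard in \<open>copy_index\<close> makes this true for every pair of naturals. A
  sampled pair lies in \<open>index_pairs N\<close> only almost surely, whereas measurability and
  moments are wanted at every sample point.\<close>

lemma copy_index_in: "a \<in> {1..N} \<Longrightarrow> copy_index N q a \<in> {1..N}"
  by (auto simp: copy_index_def)

section \<open>Elementary properties and measurability of the recursions\<close>

lemma gap_same: "gap N \<sigma> \<pi> y h n a a = 0"
  by (induction n arbitrary: a) (auto simp: spread_step_def)

lemma gap_nonneg: "(\<And>i. i < n \<Longrightarrow> 0 \<le> h i) \<Longrightarrow> 0 \<le> gap N \<sigma> \<pi> y h n a b"
  by (induction n arbitrary: a b) (auto simp: spread_step_def)

lemma gap_cong:
  "(\<And>i. i \<in> {1..n} \<Longrightarrow> \<pi> i = \<pi>' i) \<Longrightarrow> gap N \<sigma> \<pi> y h n a b = gap N \<sigma> \<pi>' y h n a b"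
  by (induction n arbitrary: a b) (auto simp: spread_step_def)

lemma post_cong: "(\<And>i. i < n \<Longrightarrow> h i = h' i) \<Longrightarrow> post r \<sigma> v h n = post r \<sigma> v h' n"
  by (induction n) auto

text \<open>Separates the initial value from the durations of the flights;
  \<open>window_initial_average\<close> rests on it.\<close>

lemma post_linear: "post r \<sigma> v h n = r ^ n * v + post r \<sigma> 0 h n"
  by (induction n) (auto simp: algebra_simps)

lemma post_nonneg:
  "0 \<le> r \<Longrightarrow> 0 \<le> v \<Longrightarrow> (\<And>i. i < n \<Longrightarrow> 0 \<le> h i) \<Longrightarrow> 0 \<le> post r \<sigma> v h n"
  by (induction n) auto

text \<open>Replacing the factor \<open>r\<close> by 1 leaves only the growth by free motion. The
  bound controls the remainder of the telescoping in \<open>renewal_sum\<close>.\<close>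

lemma post_le:
  assumes "0 \<le> r" "r \<le> 1" "0 \<le> v" "\<And>i. i < n \<Longrightarrow> 0 \<le> h i"
  shows "post r \<sigma> v h n \<le> v + \<sigma>\<^sup>2 * (\<Sum>i<n. h i)"
  using assms(4)
proof (induction n)
  case (Suc n)
  have "post r \<sigma> v h (Suc n) \<le> post r \<sigma> v h n + \<sigma>\<^sup>2 * h n"
    using assms Suc.prems post_nonneg[of r v n h \<sigma>]
    by (auto intro!: mult_left_le_one_le add_nonneg_nonneg)
  with Suc show ?case by (simp add: algebra_simps)
qed simp

text \<open>The index is random, but it stays in the finite set \<open>{1..N}\<close>, on which
  \<open>F\<close> is assumed measurable.\<close>

lemma measurable_copy_index:
  assumes "\<And>c. c \<in> {1..N} \<Longrightarrow> (\<lambda>\<omega>. F \<omega> c) \<in> measurable L K"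
    and [measurable]: "q \<in> measurable L (count_space UNIV)" and "a \<in> {1..N}"
  shows "(\<lambda>\<omega>. F \<omega> (copy_index N (q \<omega>) a)) \<in> measurable L K"
proof (rule measurable_compose_countable'[where I = "{1..N}" and f = "\<lambda>c \<omega>. F \<omega> c"])
  have "(\<lambda>\<omega>. copy_index N (q \<omega>) a) \<in> measurable L (count_space UNIV)" by measurable
  then show "(\<lambda>\<omega>. copy_index N (q \<omega>) a) \<in> measurable L (count_space {1..N})"
    using copy_index_in[OF assms(3)] by (auto intro!: measurable_count_space_extend[of _ UNIV] simp: measurable_def)
qed (use assms in auto)

lemma measurable_chain:
  assumes \<pi>: "\<And>i. i \<in> {1..n} \<Longrightarrow> (\<lambda>\<omega>. \<pi> \<omega> i) \<in> measurable L (count_space UNIV)"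
    and y: "\<And>c. c \<in> {1..N} \<Longrightarrow> (\<lambda>\<omega>. y \<omega> c) \<in> borel_measurable L"
    and \<xi>: "\<And>i c. i < n \<Longrightarrow> c \<in> {1..N} \<Longrightarrow> (\<lambda>\<omega>. \<xi> \<omega> i c) \<in> borel_measurable L"
    and "a \<in> {1..N}"
  shows "(\<lambda>\<omega>. chain N \<sigma> (\<pi> \<omega>) (y \<omega>) (\<xi> \<omega>) n a) \<in> borel_measurable L"
  using \<pi> \<xi> assms(4)
proof (induction n arbitrary: a)
  case (Suc n)
  show ?case unfolding chain.simps Let_def
  proof (rule measurable_copy_index)
    fix c assume c: "c \<in> {1..N}"
    have [measurable]: "(\<lambda>\<omega>. chain N \<sigma> (\<pi> \<omega>) (y \<omega>) (\<xi> \<omega>) n c) \<in> borel_measurable L"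
      "(\<lambda>\<omega>. \<xi> \<omega> n c) \<in> borel_measurable L"
      using Suc c by auto
    show "(\<lambda>\<omega>. chain N \<sigma> (\<pi> \<omega>) (y \<omega>) (\<xi> \<omega>) n c + \<sigma> * \<xi> \<omega> n c) \<in> borel_measurable L" by measurable
  qed (use Suc.prems in auto)
qed (auto simp: y)

lemma measurable_gap:
  assumes \<pi>: "\<And>i. i \<in> {1..n} \<Longrightarrow> (\<lambda>\<omega>. \<pi> \<omega> i) \<in> measurable L (count_space UNIV)"
    and y: "\<And>c. c \<in> {1..N} \<Longrightarrow> (\<lambda>\<omega>. y \<omega> c) \<in> borel_measurable L"
    and h: "\<And>i. i < n \<Longrightarrow> (\<lambda>\<omega>. h \<omega> i) \<in> borel_measurable L"
    and "a \<in> {1..N}" "b \<in> {1..N}"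
  shows "(\<lambda>\<omega>. gap N \<sigma> (\<pi> \<omega>) (y \<omega>) (h \<omega>) n a b) \<in> borel_measurable L"
  using \<pi> h assms(4,5)
proof (induction n arbitrary: a b)
  case 0
  then have [measurable]: "(\<lambda>\<omega>. y \<omega> a) \<in> borel_measurable L" "(\<lambda>\<omega>. y \<omega> b) \<in> borel_measurable L"
    using y by auto
  show ?case by simp
next
  case (Suc n)
  have \<pi>: "(\<lambda>\<omega>. \<pi> \<omega> (Suc n)) \<in> measurable L (count_space UNIV)" using Suc by auto
  show ?case unfolding gap.simps
  proof (rule measurable_copy_index[OF _ \<pi> Suc.prems(4)], rule measurable_copy_index[OF _ \<pi> Suc.prems(3)])
    fix c d assume c: "c \<in> {1..N}" "d \<in> {1..N}"
    have [measurable]: "(\<lambda>\<omega>. gap N \<sigma> (\<pi> \<omega>) (y \<omega>) (h \<omega>) n d c) \<in> borel_measurable L"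
      "(\<lambda>\<omega>. h \<omega> n) \<in> borel_measurable L"
      using Suc c by auto
    show "(\<lambda>\<omega>. spread_step \<sigma> (h \<omega> n) (gap N \<sigma> (\<pi> \<omega>) (y \<omega>) (h \<omega>) n) d c) \<in> borel_measurable L"
      unfolding spread_step_def by measurable
  qed
qed

lemma measurable_post:
  assumes [measurable]: "\<And>i. i < n \<Longrightarrow> (\<lambda>\<omega>. h \<omega> i) \<in> borel_measurable L" "v \<in> borel_measurable L"
  shows "(\<lambda>\<omega>. post r \<sigma> (v \<omega>) (h \<omega>) n) \<in> borel_measurable L"
  using assms by (induction n) simp_all

subsection \<open>Orthogonal noise and decoupling\<close>

context prob_space
begin

section \<open>Second moments of a chain driven by uncorrelated noise\<close>

lemma integrable_mult_of_squares:
  fixes f g :: "'a \<Rightarrow> real"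
  assumes [measurable]: "f \<in> borel_measurable M" "g \<in> borel_measurable M"
    and "integrable M (\<lambda>x. (f x)\<^sup>2)" "integrable M (\<lambda>x. (g x)\<^sup>2)"
  shows "integrable M (\<lambda>x. f x * g x)"
proof (rule Bochner_Integration.integrable_bound)
  show "integrable M (\<lambda>x. (f x)\<^sup>2 + (g x)\<^sup>2)" using assms by simp
  have "\<bar>u * v\<bar> \<le> u\<^sup>2 + v\<^sup>2" for u v :: real
  proof -
    have "0 \<le> (\<bar>u\<bar> - \<bar>v\<bar>)\<^sup>2" "0 \<le> \<bar>u\<bar> * \<bar>v\<bar>" by simp_all
    then show ?thesis unfolding power2_diff abs_mult power2_abs by linarith
  qed
  then show "AE x in M. norm (f x * g x) \<le> norm ((f x)\<^sup>2 + (g x)\<^sup>2)" by simp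
qed measurable

lemma square_integrable_linear:
  fixes f g :: "'a \<Rightarrow> real"
  assumes [measurable]: "f \<in> borel_measurable M" "g \<in> borel_measurable M"
    and "integrable M (\<lambda>x. (f x)\<^sup>2)" "integrable M (\<lambda>x. (g x)\<^sup>2)"
  shows "integrable M (\<lambda>x. (f x + c * g x)\<^sup>2)"
proof -
  have "integrable M (\<lambda>x. (f x)\<^sup>2 + c\<^sup>2 * (g x)\<^sup>2 + 2 * c * (f x * g x))"
    using assms integrable_mult_of_squares[OF assms] by simp
  then show ?thesis by (simp add: power2_sum algebra_simps)
qed

text \<open>The position after \<open>n\<close> epochs is an entry of \<open>y\<close> plus \<sigma>
  times a sum of terms \<open>\<xi> i k\<close> with \<open>i < n\<close>; centred, uncorrelated
  noise makes it orthogonal to all later noise. Square integrability is carried through the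
  induction so that the products are integrable and their expectations split.\<close>

lemma chain_orthogonal_noise:
  fixes \<xi> :: "nat \<Rightarrow> nat \<Rightarrow> 'a \<Rightarrow> real" and \<sigma> :: real
    and \<pi> :: "nat \<Rightarrow> nat \<times> nat" and y :: "nat \<Rightarrow> real"
  assumes meas: "\<And>i k. k \<in> {1..N} \<Longrightarrow> \<xi> i k \<in> borel_measurable M"
    and sq: "\<And>i k. k \<in> {1..N} \<Longrightarrow> integrable M (\<lambda>\<omega>. (\<xi> i k \<omega>)\<^sup>2)"
    and mean: "\<And>i k. k \<in> {1..N} \<Longrightarrow> expectation (\<xi> i k) = 0"
    and orth: "\<And>i k j l. k \<in> {1..N} \<Longrightarrow> l \<in> {1..N} \<Longrightarrow> i \<noteq> j \<or> k \<noteq> l \<Longrightarrow>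
        expectation (\<lambda>\<omega>. \<xi> i k \<omega> * \<xi> j l \<omega>) = 0"
    and a: "a \<in> {1..N}"
  defines "X \<equiv> \<lambda>n a \<omega>. chain N \<sigma> \<pi> y (\<lambda>i k. \<xi> i k \<omega>) n a"
  shows "X n a \<in> borel_measurable M \<and> integrable M (\<lambda>\<omega>. (X n a \<omega>)\<^sup>2) \<and>
    (\<forall>j\<ge>n. \<forall>k\<in>{1..N}. expectation (\<lambda>\<omega>. X n a \<omega> * \<xi> j k \<omega>) = 0)"
  using a
proof (induction n arbitrary: a)
  case 0
  then show ?case using mean by (simp add: X_def)
next
  case (Suc n)
  define c where "c = copy_index N (\<pi> (Suc n)) a"
  have c: "c \<in> {1..N}" using copy_index_in Suc.prems by (simp add: c_def)
  have X: "X (Suc n) a \<omega> = X n c \<omega> + \<sigma> * \<xi> n c \<omega>" for \<omega>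
    by (simp add: X_def c_def Let_def)
  note IH = Suc.IH[OF c]
  have m[measurable]: "X n c \<in> borel_measurable M" "\<xi> n c \<in> borel_measurable M"
    using IH meas c by auto
  have i: "integrable M (\<lambda>\<omega>. (X n c \<omega>)\<^sup>2)" "integrable M (\<lambda>\<omega>. (\<xi> n c \<omega>)\<^sup>2)"
    using IH sq c by auto
  show ?case unfolding X
  proof (intro conjI allI impI ballI)
    show "(\<lambda>\<omega>. X n c \<omega> + \<sigma> * \<xi> n c \<omega>) \<in> borel_measurable M" by measurable
    show "integrable M (\<lambda>\<omega>. (X n c \<omega> + \<sigma> * \<xi> n c \<omega>)\<^sup>2)"
      by (rule square_integrable_linear[OF m i])
    fix j k assume jk: "Suc n \<le> j" "k \<in> {1..N}"
    have "integrable M (\<lambda>\<omega>. X n c \<omega> * \<xi> j k \<omega>)" "integrable M (\<lambda>\<omega>. \<xi> n c \<omega> * \<xi> j k \<omega>)"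
      using jk by (auto intro!: integrable_mult_of_squares i sq meas m)
    then have "expectation (\<lambda>\<omega>. (X n c \<omega> + \<sigma> * \<xi> n c \<omega>) * \<xi> j k \<omega>)
       = expectation (\<lambda>\<omega>. X n c \<omega> * \<xi> j k \<omega>) + \<sigma> * expectation (\<lambda>\<omega>. \<xi> n c \<omega> * \<xi> j k \<omega>)"
      by (simp add: distrib_right mult.assoc)
    also have "\<dots> = 0" using IH orth[OF c, of k n j] jk by auto
    finally show "expectation (\<lambda>\<omega>. (X n c \<omega> + \<sigma> * \<xi> n c \<omega>) * \<xi> j k \<omega>) = 0" .
  qed
qed

text \<open>Stated for the end of a flight, where the copying that follows is a substitution of
  indices in the induction hypothesis. In the expanded square, position times noise vanishes by
  \<open>chain_orthogonal_noise\<close> and noise times noise by \<open>orth\<close>.\<close>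

lemma chain_second_moment:
  fixes \<xi> :: "nat \<Rightarrow> nat \<Rightarrow> 'a \<Rightarrow> real" and \<sigma> :: real
    and \<pi> :: "nat \<Rightarrow> nat \<times> nat" and y :: "nat \<Rightarrow> real"
  assumes meas: "\<And>i k. k \<in> {1..N} \<Longrightarrow> \<xi> i k \<in> borel_measurable M"
    and sq: "\<And>i k. k \<in> {1..N} \<Longrightarrow> integrable M (\<lambda>\<omega>. (\<xi> i k \<omega>)\<^sup>2)"
    and mean: "\<And>i k. k \<in> {1..N} \<Longrightarrow> expectation (\<xi> i k) = 0"
    and var: "\<And>i k. k \<in> {1..N} \<Longrightarrow> expectation (\<lambda>\<omega>. (\<xi> i k \<omega>)\<^sup>2) = h i"
    and orth: "\<And>i k j l. k \<in> {1..N} \<Longrightarrow> l \<in> {1..N} \<Longrightarrow> i \<noteq> j \<or> k \<noteq> l \<Longrightarrow>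
        expectation (\<lambda>\<omega>. \<xi> i k \<omega> * \<xi> j l \<omega>) = 0"
    and ab: "a \<in> {1..N}" "b \<in> {1..N}"
  defines "X \<equiv> \<lambda>n a \<omega>. chain N \<sigma> \<pi> y (\<lambda>i k. \<xi> i k \<omega>) n a"
  shows "has_bochner_integral M (\<lambda>\<omega>. ((X n a \<omega> + \<sigma> * \<xi> n a \<omega>) - (X n b \<omega> + \<sigma> * \<xi> n b \<omega>))\<^sup>2)
     (spread_step \<sigma> (h n) (gap N \<sigma> \<pi> y h n) a b)"
  using ab
proof (induction n arbitrary: a b)
  have chain: "X n a \<in> borel_measurable M" "integrable M (\<lambda>\<omega>. (X n a \<omega>)\<^sup>2)"
     "\<And>k. k \<in> {1..N} \<Longrightarrow> expectation (\<lambda>\<omega>. X n a \<omega> * \<xi> n k \<omega>) = 0" if "a \<in> {1..N}" for n a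
    using chain_orthogonal_noise[of N \<xi> a \<sigma> \<pi> y n, OF meas sq mean orth that] unfolding X_def by blast+
  \<comment> \<open>The effect of one flight on the mean squared distance \<open>D a b\<close> at
    its start, shared by the base case and the induction step.\<close>
  have *: "has_bochner_integral M (\<lambda>\<omega>. ((X n a \<omega> + \<sigma> * \<xi> n a \<omega>) - (X n b \<omega> + \<sigma> * \<xi> n b \<omega>))\<^sup>2)
     (spread_step \<sigma> (h n) D a b)"
    if g: "has_bochner_integral M (\<lambda>\<omega>. (X n a \<omega> - X n b \<omega>)\<^sup>2) (D a b)"
      and ab: "a \<in> {1..N}" "b \<in> {1..N}" and D: "D a a = 0" for D n a b
  proof (cases "a = b")
    case True
    then show ?thesis using D by (simp add: spread_step_def has_bochner_integral_zero)
  next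
    case False
    have i: "integrable M (\<lambda>\<omega>. X n c \<omega> * \<xi> n d \<omega>)" "integrable M (\<lambda>\<omega>. \<xi> n c \<omega> * \<xi> n d \<omega>)"
      if "c \<in> {1..N}" "d \<in> {1..N}" for c d
      using that by (auto intro!: integrable_mult_of_squares chain sq meas)
    have x: "has_bochner_integral M (\<lambda>\<omega>. X n c \<omega> * \<xi> n d \<omega>) 0" if "c \<in> {1..N}" "d \<in> {1..N}" for c d
      using chain(3)[OF that] i(1)[OF that] by (simp add: has_bochner_integral_iff)
    have xx: "has_bochner_integral M (\<lambda>\<omega>. \<xi> n a \<omega> * \<xi> n b \<omega>) 0"
      using orth[OF ab, of n n] i(2)[OF ab] False by (simp add: has_bochner_integral_iff)
    have x2: "has_bochner_integral M (\<lambda>\<omega>. (\<xi> n d \<omega>)\<^sup>2) (h n)" if "d \<in> {1..N}" for d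
      using var[OF that] sq[OF that] by (simp add: has_bochner_integral_iff)
    have "has_bochner_integral M (\<lambda>\<omega>. (X n a \<omega> - X n b \<omega>)\<^sup>2
        + (2 * \<sigma> * (X n a \<omega> * \<xi> n a \<omega>) - 2 * \<sigma> * (X n a \<omega> * \<xi> n b \<omega>)
           - 2 * \<sigma> * (X n b \<omega> * \<xi> n a \<omega>) + 2 * \<sigma> * (X n b \<omega> * \<xi> n b \<omega>))
        + (\<sigma>\<^sup>2 * (\<xi> n a \<omega>)\<^sup>2 + \<sigma>\<^sup>2 * (\<xi> n b \<omega>)\<^sup>2 - 2 * \<sigma>\<^sup>2 * (\<xi> n a \<omega> * \<xi> n b \<omega>)))
       (D a b + (2 * \<sigma> * 0 - 2 * \<sigma> * 0 - 2 * \<sigma> * 0 + 2 * \<sigma> * 0)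
         + (\<sigma>\<^sup>2 * h n + \<sigma>\<^sup>2 * h n - 2 * \<sigma>\<^sup>2 * 0))"
      by (intro has_bochner_integral_add has_bochner_integral_diff has_bochner_integral_mult_right
          g x xx x2 ab)
    also have "(\<lambda>\<omega>. (X n a \<omega> - X n b \<omega>)\<^sup>2
        + (2 * \<sigma> * (X n a \<omega> * \<xi> n a \<omega>) - 2 * \<sigma> * (X n a \<omega> * \<xi> n b \<omega>)
           - 2 * \<sigma> * (X n b \<omega> * \<xi> n a \<omega>) + 2 * \<sigma> * (X n b \<omega> * \<xi> n b \<omega>))
        + (\<sigma>\<^sup>2 * (\<xi> n a \<omega>)\<^sup>2 + \<sigma>\<^sup>2 * (\<xi> n b \<omega>)\<^sup>2 - 2 * \<sigma>\<^sup>2 * (\<xi> n a \<omega> * \<xi> n b \<omega>)))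
      = (\<lambda>\<omega>. ((X n a \<omega> + \<sigma> * \<xi> n a \<omega>) - (X n b \<omega> + \<sigma> * \<xi> n b \<omega>))\<^sup>2)"
      by (rule ext) (simp add: power2_eq_square algebra_simps)
    finally show ?thesis using False by (simp add: spread_step_def mult_ac)
  qed
  {
    case 0
    show ?case
      by (rule *[OF _ 0]) (auto simp: X_def has_bochner_integral_iff prob_space)
  next
    case (Suc n)
    let ?c = "copy_index N (\<pi> (Suc n))"
    have "has_bochner_integral M (\<lambda>\<omega>. (X (Suc n) a \<omega> - X (Suc n) b \<omega>)\<^sup>2) (gap N \<sigma> \<pi> y h (Suc n) a b)"
      using Suc.IH[OF copy_index_in[OF Suc.prems(1)] copy_index_in[OF Suc.prems(2)], of "\<pi> (Suc n)" "\<pi> (Suc n)"]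
      by (simp add: X_def Let_def)
    then show ?case by (rule *[OF _ Suc.prems]) (simp add: gap_same del: gap.simps)
  }
qed

section \<open>Increments of the Brownian motion at fixed times\<close>

lemma brownian_increment_moments:
  assumes W: "standard_brownian_motion W" and st: "0 \<le> s" "s \<le> t"
  shows "integrable M (\<lambda>\<omega>. (W t \<omega> - W s \<omega>)\<^sup>2)"
    and "expectation (\<lambda>\<omega>. (W t \<omega> - W s \<omega>)\<^sup>2) = t - s"
    and "integrable M (\<lambda>\<omega>. W t \<omega> - W s \<omega>)"
    and "expectation (\<lambda>\<omega>. W t \<omega> - W s \<omega>) = 0"
proof -
  have *: "integrable M (\<lambda>\<omega>. (W t \<omega> - W s \<omega>)\<^sup>2) \<and> expectation (\<lambda>\<omega>. (W t \<omega> - W s \<omega>)\<^sup>2) = t - s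
     \<and> integrable M (\<lambda>\<omega>. W t \<omega> - W s \<omega>) \<and> expectation (\<lambda>\<omega>. W t \<omega> - W s \<omega>) = 0"
  \<comment> \<open>Increments of length 0 do occur, since the epochs will be cut off at the
    observation time; they have no normal density.\<close>
  proof (cases "s = t")
    case False
    then have "s < t" using st by simp
    then have d: "distributed M lborel (\<lambda>\<omega>. W t \<omega> - W s \<omega>) (normal_density 0 (sqrt (t - s)))"
      using W st(1) unfolding standard_brownian_motion_def by blast
    have pos: "0 < sqrt (t - s)" using \<open>s < t\<close> by simp
    have e: "expectation (\<lambda>\<omega>. W t \<omega> - W s \<omega>) = 0"
      using normal_distributed_expectation[OF pos d] .
    have v: "expectation (\<lambda>\<omega>. (W t \<omega> - W s \<omega>)\<^sup>2) = t - s"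
      using normal_distributed_variance[OF pos d] e \<open>s < t\<close> by simp
    have i: "integrable M (\<lambda>\<omega>. (W t \<omega> - W s \<omega>) ^ k)" for k
      using integrable_normal_moment[OF pos, of 0 k]
      by (subst distributed_integrable[OF d, symmetric]) auto
    show ?thesis using e v i[of 2] i[of 1] by simp
  qed simp
  then show "integrable M (\<lambda>\<omega>. (W t \<omega> - W s \<omega>)\<^sup>2)" "expectation (\<lambda>\<omega>. (W t \<omega> - W s \<omega>)\<^sup>2) = t - s"
    "integrable M (\<lambda>\<omega>. W t \<omega> - W s \<omega>)" "expectation (\<lambda>\<omega>. W t \<omega> - W s \<omega>) = 0" by auto
qed

lemma indep_vars_imp_indep_var:
  assumes "indep_vars S X I" "i \<in> I" "j \<in> I" "i \<noteq> j"
  shows "indep_var (S i) (X i) (S j) (X j)"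
proof -
  have "indep_var (S i) ((\<lambda>f. f i) \<circ> (\<lambda>\<omega>. restrict (\<lambda>i. X i \<omega>) {i}))
      (S j) ((\<lambda>f. f j) \<circ> (\<lambda>\<omega>. restrict (\<lambda>i. X i \<omega>) {j}))"
    using assms by (intro indep_var_compose[OF indep_var_restrict[OF assms(1)]]) auto
  then show ?thesis by (simp add: comp_def)
qed

text \<open>For one particle this is independence of increments along \<open>u\<close>; for two
  particles it is independence of their paths, of which the increments are measurable
  functions.\<close>

lemma brownian_increments_orthogonal:
  assumes B: "standard_brownian_motion_dim N B" and u: "mono u" "0 \<le> u 0"
    and kl: "k \<in> {1..N}" "l \<in> {1..N}" and ne: "i \<noteq> j \<or> k \<noteq> l"
  shows "expectation (\<lambda>\<omega>. (B k (u (Suc i)) \<omega> - B k (u i) \<omega>) * (B l (u (Suc j)) \<omega> - B l (u j) \<omega>)) = 0"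
proof -
  have BM: "standard_brownian_motion (B k)" if "k \<in> {1..N}" for k
    using B that by (simp add: standard_brownian_motion_dim_def)
  have u0: "0 \<le> u i" for i using u monoD[OF u(1), of 0 i] by simp
  have u1: "u i \<le> u (Suc i)" for i using monoD[OF u(1)] by simp
  note mom = brownian_increment_moments[OF BM u0 u1]
  have "indep_var borel (\<lambda>\<omega>. B k (u (Suc i)) \<omega> - B k (u i) \<omega>) borel (\<lambda>\<omega>. B l (u (Suc j)) \<omega> - B l (u j) \<omega>)"
  proof (cases "k = l")
    case True
    have "indep_vars (\<lambda>_. borel) (\<lambda>i \<omega>. B k (u (Suc i)) \<omega> - B k (u i) \<omega>) {..<Suc (max i j)}"
      using BM[OF kl(1)] u unfolding standard_brownian_motion_def by blast
    from indep_vars_imp_indep_var[OF this, of i j] show ?thesis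
      using True ne by simp
  next
    case False
    have v: "indep_vars (\<lambda>_. \<Pi>\<^sub>M t\<in>{0..}. borel) (\<lambda>k \<omega>. \<lambda>t\<in>{0..}. B k t \<omega>) {1..N}"
      using B by (simp add: standard_brownian_motion_dim_def)
    have m: "(\<lambda>f. f (u (Suc i)) - f (u i)) \<in> borel_measurable (\<Pi>\<^sub>M t\<in>{0..}. borel :: real measure)" for i
      by (intro borel_measurable_diff measurable_component_singleton) (auto simp: u0)
    from indep_var_compose[OF indep_vars_imp_indep_var[OF v kl False] m m, of i j]
    show ?thesis by (simp add: comp_def u0)
  qed
  from indep_var_lebesgue_integral[OF this] show ?thesis
    using mom(3,4) kl by simp
qed

text \<open>Independence makes the joint law a product, so Tonelli's theorem applies. The result is
  written over two sample points instead of two laws, ready for identity maps as \<open>X\<close>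
  and \<open>Y\<close>.\<close>

lemma nn_integral_indep_var:
  assumes i: "indep_var S X T Y" and f[measurable]: "f \<in> borel_measurable (S \<Otimes>\<^sub>M T)"
  shows "(\<integral>\<^sup>+\<omega>. f (X \<omega>, Y \<omega>) \<partial>M) = (\<integral>\<^sup>+\<omega>'. \<integral>\<^sup>+\<omega>. f (X \<omega>', Y \<omega>) \<partial>M \<partial>M)"
proof -
  have XY[measurable]: "X \<in> measurable M S" "Y \<in> measurable M T"
    and eq: "distr M S X \<Otimes>\<^sub>M distr M T Y = distr M (S \<Otimes>\<^sub>M T) (\<lambda>\<omega>. (X \<omega>, Y \<omega>))"
    using i unfolding indep_var_distribution_eq by auto
  interpret Y: prob_space "distr M T Y" by (rule prob_space_distr) simp
  have "(\<integral>\<^sup>+\<omega>. f (X \<omega>, Y \<omega>) \<partial>M) = integral\<^sup>N (distr M (S \<Otimes>\<^sub>M T) (\<lambda>\<omega>. (X \<omega>, Y \<omega>))) f"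
    by (subst nn_integral_distr) auto
  also have "\<dots> = (\<integral>\<^sup>+x. \<integral>\<^sup>+y. f (x, y) \<partial>distr M T Y \<partial>distr M S X)"
    unfolding eq[symmetric] by (subst Y.nn_integral_fst[symmetric]) auto
  also have "\<dots> = (\<integral>\<^sup>+\<omega>'. \<integral>\<^sup>+y. f (X \<omega>', y) \<partial>distr M T Y \<partial>M)"
    by (subst nn_integral_distr) (auto intro!: Y.borel_measurable_nn_integral)
  also have "\<dots> = (\<integral>\<^sup>+\<omega>'. \<integral>\<^sup>+\<omega>. f (X \<omega>', Y \<omega>) \<partial>M \<partial>M)"
    by (intro nn_integral_cong, subst nn_integral_distr) (auto intro!: measurable_Pair2[of f] dest: measurable_space[OF XY(1)])
  finally show ?thesis .
qed

end

subsection \<open>Renewal at exponential epochs\<close>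

definition relaxation :: "real \<Rightarrow> real \<Rightarrow> real \<Rightarrow> real \<Rightarrow> real \<Rightarrow> real" where
  "relaxation \<sigma> \<delta> l v t = \<sigma>\<^sup>2 / \<delta> * l * (1 - exp (- (\<delta> * t / l))) + exp (- (\<delta> * t / l)) * v"

lemma relaxation_nonneg:
  "\<delta> > 0 \<Longrightarrow> l > 0 \<Longrightarrow> v \<ge> 0 \<Longrightarrow> t \<ge> 0 \<Longrightarrow> relaxation \<sigma> \<delta> l v t \<ge> 0"
  by (simp add: relaxation_def)

text \<open>Copying only lowers the mean, so free motion gives an upper bound; analytically this is
  1 - exp(-u) \<le> u.\<close>

lemma relaxation_le:
  assumes "\<delta> > 0" "l > 0" "v \<ge> 0" "t \<ge> 0"
  shows "relaxation \<sigma> \<delta> l v t \<le> v + \<sigma>\<^sup>2 * t"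
proof -
  have "1 - exp (- (\<delta> * t / l)) \<le> \<delta> * t / l"
    using exp_ge_add_one_self[of "- (\<delta> * t / l)"] by simp
  then have "\<sigma>\<^sup>2 / \<delta> * l * (1 - exp (- (\<delta> * t / l))) \<le> \<sigma>\<^sup>2 / \<delta> * l * (\<delta> * t / l)"
    using assms by (intro mult_left_mono) auto
  moreover have "exp (- (\<delta> * t / l)) * v \<le> v"
    using assms by (intro mult_left_le_one_le) auto
  ultimately show ?thesis using assms by (simp add: relaxation_def)
qed

text \<open>Conditioning on the first epoch: \<open>e\<^sup>-\<^sup>\<delta>\<^sup>h W(v + \<sigma>\<^sup>2 h, t - h)\<close> is, up to sign, an antiderivative of
  the integrand on \<open>{0..t}\<close>, where \<open>W = relaxation \<sigma> \<delta> l\<close>.\<close>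

lemma relaxation_renewal:
  assumes pos: "\<delta> > 0" "l \<ge> 1" "v \<ge> 0" "t \<ge> 0"
  shows "(\<integral>\<^sup>+h. ennreal (exponential_density \<delta> h) *
      ennreal (if t < h then v + \<sigma>\<^sup>2 * t
               else relaxation \<sigma> \<delta> l ((1 - 1 / l) * (v + \<sigma>\<^sup>2 * h)) (t - h)) \<partial>lborel)
    = ennreal (relaxation \<sigma> \<delta> l v t)"
proof -
  let ?W = "relaxation \<sigma> \<delta> l"
  define f where "f h = \<delta> * exp (- \<delta> * h) * ?W ((1 - 1 / l) * (v + \<sigma>\<^sup>2 * h)) (t - h)" for h
  define G where "G h = - exp (- \<delta> * h) * ?W (v + \<sigma>\<^sup>2 * h) (t - h)" for h
  define c where "c = v + \<sigma>\<^sup>2 * t"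
  have l: "l > 0" "0 \<le> 1 - 1 / l" using pos by auto
  have W: "0 \<le> ?W ((1 - 1 / l) * (v + \<sigma>\<^sup>2 * h)) (t - h)" if "0 \<le> h" "h \<le> t" for h
    using that pos l by (intro relaxation_nonneg mult_nonneg_nonneg) auto
  have G: "(G has_real_derivative f h) (at h)" for h
  proof -
    \<comment> \<open>The derivative as the product rule delivers it. With u =
      \<open>v + \<sigma>\<^sup>2 * h\<close>, the differential equation of
      \<open>relaxation\<close> turns the second term into \<open>exp (- \<delta> * h)\<close> times
      (\<delta> / l) times the slope in the initial value times u; subtracting it lowers the initial
      value from u to \<open>(1 - 1 / l)\<close> u.\<close>
    define D where "D = \<delta> * exp (- \<delta> * h) * (\<sigma>\<^sup>2 / \<delta> * l * (1 - exp (- (\<delta> * (t - h) / l)))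
        + exp (- (\<delta> * (t - h) / l)) * (v + \<sigma>\<^sup>2 * h))
      - exp (- \<delta> * h) * (- (\<sigma>\<^sup>2 / \<delta> * l * (exp (- (\<delta> * (t - h) / l)) * (\<delta> / l)))
        + (exp (- (\<delta> * (t - h) / l)) * (\<delta> / l) * (v + \<sigma>\<^sup>2 * h) + exp (- (\<delta> * (t - h) / l)) * \<sigma>\<^sup>2))"
    have "(G has_real_derivative D) (at h)"
      unfolding G_def relaxation_def D_def
      by (auto intro!: derivative_eq_intros)
    moreover have "D = f h"
      unfolding D_def f_def relaxation_def using pos l by (simp add: field_simps)
    ultimately show ?thesis by simp
  qed
  have "(\<integral>\<^sup>+h. ennreal (exponential_density \<delta> h) *
      ennreal (if t < h then c else ?W ((1 - 1 / l) * (v + \<sigma>\<^sup>2 * h)) (t - h)) \<partial>lborel)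
    = (\<integral>\<^sup>+h. ennreal (f h) * indicator {0..t} h
         + ennreal (c * (\<delta> * exp (- \<delta> * h))) * indicator {t..} h \<partial>lborel)"
  \<comment> \<open>The two closed intervals share the point \<open>t\<close>, a null set.\<close>
  proof (rule nn_integral_cong_AE, use AE_lborel_singleton[of t] in eventually_elim)
    fix h assume "h \<noteq> t"
    then consider "h < 0" | "0 \<le> h" "h < t" | "t < h" by linarith
    then show "ennreal (exponential_density \<delta> h) *
      ennreal (if t < h then c else ?W ((1 - 1 / l) * (v + \<sigma>\<^sup>2 * h)) (t - h))
      = ennreal (f h) * indicator {0..t} h + ennreal (c * (\<delta> * exp (- \<delta> * h))) * indicator {t..} h"
    proof cases
      case 2
      then show ?thesis using W[of h] pos
        by (simp add: erlang_density_def f_def ennreal_mult mult_ac)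
    next
      case 3
      then show ?thesis using pos
        by (simp add: erlang_density_def c_def ennreal_mult' mult_ac)
    qed (use pos in \<open>simp_all add: erlang_density_def\<close>)
  qed
  also have "\<dots> = (\<integral>\<^sup>+h. ennreal (f h) * indicator {0..t} h \<partial>lborel)
      + (\<integral>\<^sup>+h. ennreal (c * (\<delta> * exp (- \<delta> * h))) * indicator {t..} h \<partial>lborel)"
    by (rule nn_integral_add) (simp_all add: f_def relaxation_def)
  also have "(\<integral>\<^sup>+h. ennreal (f h) * indicator {0..t} h \<partial>lborel) = ennreal (G t - G 0)"
  proof (rule nn_integral_FTC_Icc)
    show "f \<in> borel_measurable borel" unfolding f_def relaxation_def by measurable
    fix h assume "h \<in> {0..t}"
    then show "0 \<le> f h" unfolding f_def using W[of h] pos by simp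
  qed (use pos G in auto)
  also have "(\<integral>\<^sup>+h. ennreal (c * (\<delta> * exp (- \<delta> * h))) * indicator {t..} h \<partial>lborel)
      = ennreal (0 - (- c * exp (- \<delta> * t)))"
  proof (rule nn_integral_FTC_atLeast)
    fix h assume "t \<le> h"
    show "((\<lambda>h. - c * exp (- \<delta> * h)) has_real_derivative c * (\<delta> * exp (- \<delta> * h))) (at h)"
      by (auto intro!: derivative_eq_intros)
    show "0 \<le> c * (\<delta> * exp (- \<delta> * h))" using pos by (simp add: c_def)
  next
    show "((\<lambda>h. - c * exp (- \<delta> * h)) \<longlongrightarrow> 0) at_top"
      using pos by real_asymp
  qed simp
  also have "ennreal (G t - G 0) + ennreal (0 - (- c * exp (- \<delta> * t))) = ennreal (G t - G 0 + c * exp (- \<delta> * t))"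
  proof -
    have "G 0 \<le> G t"
    proof (rule DERIV_nonneg_imp_nondecreasing[OF pos(4)])
      fix h assume "0 \<le> h" "h \<le> t"
      then have "0 \<le> f h" using W pos by (simp add: f_def)
      with G show "\<exists>y. (G has_real_derivative y) (at h) \<and> 0 \<le> y" by blast
    qed
    moreover have "0 \<le> c * exp (- \<delta> * t)" using pos by (simp add: c_def)
    ultimately show ?thesis by (subst ennreal_plus[symmetric]) simp_all
  qed
  also have "G t - G 0 + c * exp (- \<delta> * t) = ?W v t"
    by (simp add: G_def c_def relaxation_def)
  finally show ?thesis unfolding c_def .
qed

context prob_space
begin

text \<open>Chernoff's bound with exponent \<delta>, for which each factor has the mean \<delta> /
  (\<delta> + \<delta>) = 1/2.\<close>

lemma exponential_sum_tail:
  fixes H :: "nat \<Rightarrow> 'a \<Rightarrow> real" and \<delta> t :: real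
  assumes \<delta>: "\<delta> > 0"
    and ind: "indep_vars (\<lambda>_. borel) H UNIV"
    and ex: "\<And>n. distributed M lborel (H n) (exponential_density \<delta>)"
  shows "emeasure M {\<omega> \<in> space M. (\<Sum>i<n. H i \<omega>) \<le> t} \<le> ennreal (exp (\<delta> * t) * (1 / 2) ^ n)"
proof -
  have [measurable]: "\<And>i. H i \<in> borel_measurable M" using ind by (auto simp: indep_vars_def)
  have one: "(\<integral>\<^sup>+\<omega>. ennreal (exp (- \<delta> * H i \<omega>)) \<partial>M) = ennreal (1 / 2)" for i
  proof -
    have "(\<integral>\<^sup>+\<omega>. ennreal (exp (- \<delta> * H i \<omega>)) \<partial>M)
        = (\<integral>\<^sup>+h. ennreal (exponential_density \<delta> h) * ennreal (exp (- \<delta> * h)) \<partial>lborel)"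
      by (rule distributed_nn_integral[OF ex, symmetric]) simp
    also have "\<dots> = (\<integral>\<^sup>+h. ennreal (1 / 2) * ennreal (exponential_density (2 * \<delta>) h) \<partial>lborel)"
    proof (rule nn_integral_cong)
      fix h
      have "exponential_density \<delta> h * exp (- \<delta> * h) = 1 / 2 * exponential_density (2 * \<delta>) h"
        by (simp add: erlang_density_def mult_exp_exp)
      then show "ennreal (exponential_density \<delta> h) * ennreal (exp (- \<delta> * h))
          = ennreal (1 / 2) * ennreal (exponential_density (2 * \<delta>) h)"
        by (metis ennreal_mult' ennreal_mult'' exp_ge_zero zero_le_divide_1_iff zero_le_numeral)
    qed
    also have "\<dots> = ennreal (1 / 2) * emeasure (density lborel (exponential_density (2 * \<delta>))) UNIV"
      by (subst nn_integral_cmult) (auto simp: emeasure_density)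
    also have "emeasure (density lborel (exponential_density (2 * \<delta>))) UNIV = 1"
      using prob_space.emeasure_space_1[OF prob_space_exponential_density, of "2 * \<delta>"] \<delta> by simp
    finally show ?thesis by simp
  qed
  have "emeasure M {\<omega> \<in> space M. (\<Sum>i<n. H i \<omega>) \<le> t} = (\<integral>\<^sup>+\<omega>. indicator {\<omega> \<in> space M. (\<Sum>i<n. H i \<omega>) \<le> t} \<omega> \<partial>M)"
    by (subst nn_integral_indicator) auto
  also have "\<dots> \<le> (\<integral>\<^sup>+\<omega>. ennreal (exp (\<delta> * t)) * (\<Prod>i<n. ennreal (exp (- \<delta> * H i \<omega>))) \<partial>M)"
  proof (rule nn_integral_mono)
    fix \<omega> assume "\<omega> \<in> space M"
    have eq: "exp (\<delta> * t) * (\<Prod>i<n. exp (- \<delta> * H i \<omega>)) = exp (\<delta> * (t - (\<Sum>i<n. H i \<omega>)))"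
    proof -
      have "(\<Prod>i<n. exp (- \<delta> * H i \<omega>)) = exp (- \<delta> * (\<Sum>i<n. H i \<omega>))"
        by (simp only: exp_sum finite_lessThan sum_distrib_left)
      then show ?thesis by (simp only: mult_exp_exp) (simp add: right_diff_distrib)
    qed
    show "indicator {\<omega> \<in> space M. (\<Sum>i<n. H i \<omega>) \<le> t} \<omega> \<le> ennreal (exp (\<delta> * t)) * (\<Prod>i<n. ennreal (exp (- \<delta> * H i \<omega>)))"
      unfolding prod_ennreal[OF exp_ge_zero] ennreal_mult'[OF exp_ge_zero, symmetric] eq
      using \<delta> by (auto simp: indicator_def)
  qed
  also have "\<dots> = ennreal (exp (\<delta> * t)) * (\<integral>\<^sup>+\<omega>. (\<Prod>i<n. ennreal (exp (- \<delta> * H i \<omega>))) \<partial>M)"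
    by (rule nn_integral_cmult) simp
  also have "(\<integral>\<^sup>+\<omega>. (\<Prod>i<n. ennreal (exp (- \<delta> * H i \<omega>))) \<partial>M) = (\<Prod>i<n. \<integral>\<^sup>+\<omega>. ennreal (exp (- \<delta> * H i \<omega>)) \<partial>M)"
  proof (rule indep_vars_nn_integral)
    have "indep_vars (\<lambda>_. borel) (\<lambda>i. (\<lambda>h. ennreal (exp (- \<delta> * h))) \<circ> H i) {..<n}"
      by (rule indep_vars_compose[OF indep_vars_subset[OF ind]]) auto
    then show "indep_vars (\<lambda>_. borel) (\<lambda>i \<omega>. ennreal (exp (- \<delta> * H i \<omega>))) {..<n}"
      by (simp add: comp_def)
  qed auto
  also have "\<dots> = ennreal ((1 / 2) ^ n)"
    unfolding one prod_constant card_lessThan by (rule ennreal_power) simp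
  finally show ?thesis by (simp add: ennreal_mult'[symmetric])
qed

text \<open>Excludes an accumulation of epochs before \<open>t\<close>: the exceptional event lies
  in every event of \<open>exponential_sum_tail\<close>, and those probabilities tend to 0.\<close>

lemma exponential_sum_unbounded:
  fixes H :: "nat \<Rightarrow> 'a \<Rightarrow> real" and \<delta> t :: real
  assumes \<delta>: "\<delta> > 0"
    and ind: "indep_vars (\<lambda>_. borel) H UNIV"
    and ex: "\<And>n. distributed M lborel (H n) (exponential_density \<delta>)"
  shows "AE \<omega> in M. \<exists>n. t < (\<Sum>i<n. H i \<omega>)"
proof -
  have [measurable]: "\<And>i. H i \<in> borel_measurable M" using ind by (auto simp: indep_vars_def)
  let ?A = "{\<omega> \<in> space M. \<forall>n. (\<Sum>i<n. H i \<omega>) \<le> t}"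
  have "(\<lambda>n. ennreal (exp (\<delta> * t) * (1 / 2) ^ n)) \<longlonglongrightarrow> ennreal (exp (\<delta> * t) * 0)"
    by (intro tendsto_ennrealI tendsto_mult tendsto_const LIMSEQ_power_zero) simp
  moreover have "emeasure M ?A \<le> ennreal (exp (\<delta> * t) * (1 / 2) ^ n)" for n
    using exponential_sum_tail[OF assms, of n t]
    by (rule order_trans[rotated]) (rule emeasure_mono, auto)
  ultimately have "emeasure M ?A \<le> ennreal (exp (\<delta> * t) * 0)"
    by (intro LIMSEQ_le_const) auto
  then have "emeasure M ?A = 0" by simp
  then show ?thesis by (intro AE_I[of _ _ ?A]) (auto simp: not_less)
qed

text \<open>\<open>T n\<close> and \<open>V n\<close> depend on the first \<open>n\<close> flights
  only. With these frozen, \<open>relaxation_renewal\<close> expands the claimed formula over the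
  next flight \<open>H n\<close>; splitting by whether that flight passes \<open>t\<close> gives the
  two terms.\<close>

lemma renewal_step:
  fixes H :: "nat \<Rightarrow> 'a \<Rightarrow> real" and \<sigma> \<delta> l v t :: real
  assumes \<delta>: "\<delta> > 0" and l: "l \<ge> 1" and v: "v \<ge> 0"
    and ind: "indep_vars (\<lambda>_. borel) H UNIV"
    and ex: "\<And>n. distributed M lborel (H n) (exponential_density \<delta>)"
    and nonneg: "AE \<omega> in M. \<forall>n. 0 \<le> H n \<omega>"
  defines "T \<equiv> \<lambda>n \<omega>. \<Sum>i<n. H i \<omega>"
    and "V \<equiv> \<lambda>n \<omega>. post (1 - 1 / l) \<sigma> v (\<lambda>i. H i \<omega>) n"
  defines "E \<equiv> \<lambda>n. \<integral>\<^sup>+\<omega>. indicator {\<omega>. T n \<omega> \<le> t} \<omega> * ennreal (relaxation \<sigma> \<delta> l (V n \<omega>) (t - T n \<omega>)) \<partial>M"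
  shows "E n = (\<integral>\<^sup>+\<omega>. indicator {\<omega>. T n \<omega> \<le> t \<and> t < T (Suc n) \<omega>} \<omega> * ennreal (V n \<omega> + \<sigma>\<^sup>2 * (t - T n \<omega>)) \<partial>M) + E (Suc n)"
proof -
  have Hm[measurable]: "\<And>i. H i \<in> borel_measurable M" using ind by (auto simp: indep_vars_def)
  have Tm[measurable]: "T n \<in> borel_measurable M" for n unfolding T_def by measurable
  have Vm[measurable]: "V n \<in> borel_measurable M" for n unfolding V_def by (intro measurable_post) auto
  \<comment> \<open>The value reached at \<open>t\<close> if no further epoch intervenes, otherwise
    the claimed formula restarted after the next copying.\<close>
  define K where "K s w h = (if t - s < h then w + \<sigma>\<^sup>2 * (t - s)
     else relaxation \<sigma> \<delta> l ((1 - 1 / l) * (w + \<sigma>\<^sup>2 * h)) (t - s - h))" for s w h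
  \<comment> \<open>\<open>T n\<close> and \<open>V n\<close> as functions of the tuple of the first
    \<open>n\<close> flights, the form in which \<open>indep_var_restrict\<close> supplies
    them.\<close>
  define S U where "S g = (\<Sum>i<n. g i)" and "U g = post (1 - 1 / l) \<sigma> v g n" for g :: "nat \<Rightarrow> real"
  define f where "f = (\<lambda>(g, k). indicator {g. S g \<le> t} g * ennreal (K (S g) (U g) (k n)))"
  let ?P = "PiM {..<n} (\<lambda>_. borel :: real measure)" and ?Q = "PiM {n} (\<lambda>_. borel :: real measure)"
  have [measurable]: "S \<in> borel_measurable ?P" unfolding S_def by measurable
  have [measurable]: "U \<in> borel_measurable ?P" unfolding U_def by (intro measurable_post) auto
  have f: "f \<in> borel_measurable (?P \<Otimes>\<^sub>M ?Q)"
    unfolding f_def K_def relaxation_def by measurable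
  have SU: "S (restrict (\<lambda>i. H i \<omega>) {..<n}) = T n \<omega>" "U (restrict (\<lambda>i. H i \<omega>) {..<n}) = V n \<omega>" for \<omega>
    unfolding S_def U_def T_def V_def by (simp, rule post_cong, simp)
  have dec: "(\<integral>\<^sup>+\<omega>. indicator {\<omega>. T n \<omega> \<le> t} \<omega> * ennreal (K (T n \<omega>) (V n \<omega>) (H n \<omega>)) \<partial>M)
     = (\<integral>\<^sup>+\<omega>'. \<integral>\<^sup>+\<omega>. indicator {\<omega>. T n \<omega> \<le> t} \<omega>' * ennreal (K (T n \<omega>') (V n \<omega>') (H n \<omega>)) \<partial>M \<partial>M)"
    using nn_integral_indep_var[OF indep_var_restrict[OF ind, of "{..<n}" "{n}"] f]
    by (simp add: f_def SU indicator_def)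
  have "(\<integral>\<^sup>+\<omega>'. \<integral>\<^sup>+\<omega>. indicator {\<omega>. T n \<omega> \<le> t} \<omega>' * ennreal (K (T n \<omega>') (V n \<omega>') (H n \<omega>)) \<partial>M \<partial>M) = E n"
    unfolding E_def
  proof (rule nn_integral_cong_AE, use nonneg in eventually_elim)
    fix \<omega>' assume H: "\<forall>n. 0 \<le> H n \<omega>'"
    have "0 \<le> V n \<omega>'" unfolding V_def using l v H by (intro post_nonneg) auto
    have "(\<integral>\<^sup>+\<omega>. ennreal (K (T n \<omega>') (V n \<omega>') (H n \<omega>)) \<partial>M)
        = ennreal (relaxation \<sigma> \<delta> l (V n \<omega>') (t - T n \<omega>'))" if "T n \<omega>' \<le> t"
    proof -
      have "(\<integral>\<^sup>+\<omega>. ennreal (K (T n \<omega>') (V n \<omega>') (H n \<omega>)) \<partial>M) =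
          (\<integral>\<^sup>+h. ennreal (exponential_density \<delta> h) * ennreal (K (T n \<omega>') (V n \<omega>') h) \<partial>lborel)"
        by (rule distributed_nn_integral[OF ex, symmetric]) (unfold K_def relaxation_def, measurable)
      also have "\<dots> = ennreal (relaxation \<sigma> \<delta> l (V n \<omega>') (t - T n \<omega>'))"
        unfolding K_def using that \<open>0 \<le> V n \<omega>'\<close> by (intro relaxation_renewal \<delta> l) auto
      finally show ?thesis .
    qed
    then show "(\<integral>\<^sup>+\<omega>. indicator {\<omega>. T n \<omega> \<le> t} \<omega>' * ennreal (K (T n \<omega>') (V n \<omega>') (H n \<omega>)) \<partial>M)
       = indicator {\<omega>. T n \<omega> \<le> t} \<omega>' * ennreal (relaxation \<sigma> \<delta> l (V n \<omega>') (t - T n \<omega>'))"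
      by (auto simp: indicator_def)
  qed
  then have "E n = (\<integral>\<^sup>+\<omega>. indicator {\<omega>. T n \<omega> \<le> t} \<omega> * ennreal (K (T n \<omega>) (V n \<omega>) (H n \<omega>)) \<partial>M)"
    using dec by simp
  also have "\<dots> = (\<integral>\<^sup>+\<omega>. indicator {\<omega>. T n \<omega> \<le> t \<and> t < T (Suc n) \<omega>} \<omega> * ennreal (V n \<omega> + \<sigma>\<^sup>2 * (t - T n \<omega>))
     + indicator {\<omega>. T (Suc n) \<omega> \<le> t} \<omega> * ennreal (relaxation \<sigma> \<delta> l (V (Suc n) \<omega>) (t - T (Suc n) \<omega>)) \<partial>M)"
  proof (rule nn_integral_cong_AE, use nonneg in eventually_elim)
    fix \<omega> assume H: "\<forall>n. 0 \<le> H n \<omega>"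
    have T: "T (Suc n) \<omega> = T n \<omega> + H n \<omega>" by (simp add: T_def)
    have V: "V (Suc n) \<omega> = (1 - 1 / l) * (V n \<omega> + \<sigma>\<^sup>2 * H n \<omega>)" by (simp add: V_def)
    show "indicator {\<omega>. T n \<omega> \<le> t} \<omega> * ennreal (K (T n \<omega>) (V n \<omega>) (H n \<omega>))
      = indicator {\<omega>. T n \<omega> \<le> t \<and> t < T (Suc n) \<omega>} \<omega> * ennreal (V n \<omega> + \<sigma>\<^sup>2 * (t - T n \<omega>))
     + indicator {\<omega>. T (Suc n) \<omega> \<le> t} \<omega> * ennreal (relaxation \<sigma> \<delta> l (V (Suc n) \<omega>) (t - T (Suc n) \<omega>))"
      unfolding K_def using H[rule_format, of n]
      by (auto simp: indicator_def T V algebra_simps)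
  qed
  also have "\<dots> = (\<integral>\<^sup>+\<omega>. indicator {\<omega>. T n \<omega> \<le> t \<and> t < T (Suc n) \<omega>} \<omega> * ennreal (V n \<omega> + \<sigma>\<^sup>2 * (t - T n \<omega>)) \<partial>M) + E (Suc n)"
    unfolding E_def relaxation_def by (rule nn_integral_add) measurable
  finally show ?thesis .
qed

text \<open>The remainder \<open>E n\<close> is at most \<open>v + \<sigma>\<^sup>2 * t\<close>
  times the probability of \<open>T n \<omega> \<le> t\<close>, which decays geometrically.\<close>

lemma renewal_sum:
  fixes H :: "nat \<Rightarrow> 'a \<Rightarrow> real" and \<sigma> \<delta> l v t :: real
  assumes \<delta>: "\<delta> > 0" and l: "l \<ge> 1" and v: "v \<ge> 0" and t: "t \<ge> 0"
    and ind: "indep_vars (\<lambda>_. borel) H UNIV"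
    and ex: "\<And>n. distributed M lborel (H n) (exponential_density \<delta>)"
    and nonneg: "AE \<omega> in M. \<forall>n. 0 \<le> H n \<omega>"
  defines "T \<equiv> \<lambda>n \<omega>. \<Sum>i<n. H i \<omega>"
    and "V \<equiv> \<lambda>n \<omega>. post (1 - 1 / l) \<sigma> v (\<lambda>i. H i \<omega>) n"
  shows "(\<Sum>n. \<integral>\<^sup>+\<omega>. indicator {\<omega>. T n \<omega> \<le> t \<and> t < T (Suc n) \<omega>} \<omega> * ennreal (V n \<omega> + \<sigma>\<^sup>2 * (t - T n \<omega>)) \<partial>M)
    = ennreal (relaxation \<sigma> \<delta> l v t)"
proof -
  define E where "E n = (\<integral>\<^sup>+\<omega>. indicator {\<omega>. T n \<omega> \<le> t} \<omega> * ennreal (relaxation \<sigma> \<delta> l (V n \<omega>) (t - T n \<omega>)) \<partial>M)" for n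
  define s where "s n = (\<integral>\<^sup>+\<omega>. indicator {\<omega>. T n \<omega> \<le> t \<and> t < T (Suc n) \<omega>} \<omega> * ennreal (V n \<omega> + \<sigma>\<^sup>2 * (t - T n \<omega>)) \<partial>M)" for n
  have [measurable]: "\<And>i. H i \<in> borel_measurable M" using ind by (auto simp: indep_vars_def)
  have step: "E n = s n + E (Suc n)" for n
    using renewal_step[OF \<delta> l v ind ex nonneg, where n = n and t = t and \<sigma> = \<sigma>] unfolding E_def s_def T_def V_def .
  have E0: "E 0 = ennreal (relaxation \<sigma> \<delta> l v t)"
    using t by (simp add: E_def T_def V_def emeasure_space_1)
  have sumE: "(\<Sum>i<n. s i) + E n = ennreal (relaxation \<sigma> \<delta> l v t)" for n
  proof (induction n)
    case (Suc n)
    then show ?case unfolding step[of n] by (simp add: add.assoc)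
  qed (simp add: E0)
  have le: "E n \<le> ennreal ((v + \<sigma>\<^sup>2 * t) * exp (\<delta> * t) * (1 / 2) ^ n)" for n
  proof -
    have "E n \<le> (\<integral>\<^sup>+\<omega>. ennreal (v + \<sigma>\<^sup>2 * t) * indicator {\<omega> \<in> space M. T n \<omega> \<le> t} \<omega> \<partial>M)"
      unfolding E_def
    proof (rule nn_integral_mono_AE, use nonneg AE_space in eventually_elim)
      fix \<omega> assume H: "\<forall>n. 0 \<le> H n \<omega>" and \<omega>: "\<omega> \<in> space M"
      have "0 \<le> V n \<omega>" unfolding V_def using l v H by (intro post_nonneg) auto
      moreover have "V n \<omega> \<le> v + \<sigma>\<^sup>2 * T n \<omega>"
        unfolding V_def T_def using l v H by (intro post_le) auto
      ultimately have "relaxation \<sigma> \<delta> l (V n \<omega>) (t - T n \<omega>) \<le> v + \<sigma>\<^sup>2 * t" if "T n \<omega> \<le> t"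
        using relaxation_le[of \<delta> l "V n \<omega>" "t - T n \<omega>" \<sigma>] \<delta> l that by (simp add: algebra_simps)
      then show "indicator {\<omega>. T n \<omega> \<le> t} \<omega> * ennreal (relaxation \<sigma> \<delta> l (V n \<omega>) (t - T n \<omega>))
         \<le> ennreal (v + \<sigma>\<^sup>2 * t) * indicator {\<omega> \<in> space M. T n \<omega> \<le> t} \<omega>"
        using \<omega> by (auto simp: indicator_def intro!: ennreal_leI)
    qed
    also have "\<dots> = ennreal (v + \<sigma>\<^sup>2 * t) * emeasure M {\<omega> \<in> space M. T n \<omega> \<le> t}"
      unfolding T_def by (rule nn_integral_cmult_indicator) measurable
    also have "\<dots> \<le> ennreal (v + \<sigma>\<^sup>2 * t) * ennreal (exp (\<delta> * t) * (1 / 2) ^ n)"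
      unfolding T_def by (intro mult_left_mono exponential_sum_tail[OF \<delta> ind ex]) auto
    finally show ?thesis
      using v t by (subst (asm) ennreal_mult[symmetric]) (auto simp: mult.assoc)
  qed
  have "(\<lambda>n. ennreal ((v + \<sigma>\<^sup>2 * t) * exp (\<delta> * t) * (1 / 2) ^ n)) \<longlonglongrightarrow> ennreal ((v + \<sigma>\<^sup>2 * t) * exp (\<delta> * t) * 0)"
    by (intro tendsto_ennrealI tendsto_mult tendsto_const LIMSEQ_power_zero) simp
  then have lim: "(\<lambda>n. ennreal ((v + \<sigma>\<^sup>2 * t) * exp (\<delta> * t) * (1 / 2) ^ n)) \<longlonglongrightarrow> 0"
    by simp
  have "E \<longlonglongrightarrow> 0"
    by (rule tendsto_sandwich[OF _ _ tendsto_const lim]) (use le in simp_all)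
  moreover have "(\<lambda>n. \<Sum>i<n. s i) \<longlonglongrightarrow> (\<Sum>n. s n)"
    by (rule summable_LIMSEQ) simp
  ultimately have "(\<lambda>n. (\<Sum>i<n. s i) + E n) \<longlonglongrightarrow> (\<Sum>n. s n) + 0"
    by (intro tendsto_add)
  then have "(\<Sum>n. s n) = ennreal (relaxation \<sigma> \<delta> l v t)"
    unfolding sumE by (simp add: LIMSEQ_const_iff)
  then show ?thesis by (simp add: s_def)
qed

end

subsection \<open>The four independent sources\<close>

lemma measurable_generated_events:
  assumes "i \<in> I" and X: "\<And>i \<omega>. i \<in> I \<Longrightarrow> \<omega> \<in> space M \<Longrightarrow> X i \<omega> \<in> space S"
    and L: "generated_events M I S X \<subseteq> sets L" "space L = space M"
  shows "X i \<in> measurable L S"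
proof -
  let ?V = "vimage_algebra (space M) (\<lambda>\<omega>. \<lambda>i\<in>I. X i \<omega>) (\<Pi>\<^sub>M i\<in>I. S)"
  have "(\<lambda>\<omega>. \<lambda>i\<in>I. X i \<omega>) \<in> measurable ?V (\<Pi>\<^sub>M i\<in>I. S)"
    by (rule measurable_vimage_algebra1) (auto simp: space_PiM X)
  from measurable_compose[OF this measurable_component_singleton[OF \<open>i \<in> I\<close>]]
  have "X i \<in> measurable ?V S" using \<open>i \<in> I\<close> by simp
  then show ?thesis
    using L by (auto simp: measurable_def generated_events_def)
qed

lemma Int_stable_generated_events: "Int_stable (generated_events M I S X)"
  unfolding generated_events_def by (rule sets.Int_stable)

lemma (in prob_space) brownian_dim_continuous:
  assumes "standard_brownian_motion_dim N B"
  shows "AE \<omega> in M. \<forall>k\<in>{1..N}. continuous_on {0..} (\<lambda>t. B k t \<omega>)"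
  using assms unfolding standard_brownian_motion_dim_def standard_brownian_motion_def
  by (intro AE_finite_allI) auto

text \<open>Rounding down loses at most one mesh width. A random time is thereby approximated by
  times with countably many values.\<close>

lemma tendsto_floor_grid:
  fixes s :: real
  shows "(\<lambda>m. of_int \<lfloor>real (Suc m) * s\<rfloor> / real (Suc m)) \<longlonglongrightarrow> s"
proof (rule tendsto_sandwich)
  show "(\<lambda>m. s - 1 / real (Suc m)) \<longlonglongrightarrow> s"
    using tendsto_diff[OF tendsto_const LIMSEQ_inverse_real_of_nat, of s] by (simp add: inverse_eq_divide)
  show "\<forall>\<^sub>F m in sequentially. s - 1 / real (Suc m) \<le> of_int \<lfloor>real (Suc m) * s\<rfloor> / real (Suc m)"
  proof (rule always_eventually, rule allI)
    fix m
    have "real (Suc m) * s - 1 \<le> of_int \<lfloor>real (Suc m) * s\<rfloor>" by linarith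
    from divide_right_mono[OF this, of "real (Suc m)"]
    show "s - 1 / real (Suc m) \<le> of_int \<lfloor>real (Suc m) * s\<rfloor> / real (Suc m)"
      by (simp add: diff_divide_distrib del: of_nat_Suc)
  qed
  show "\<forall>\<^sub>F m in sequentially. of_int \<lfloor>real (Suc m) * s\<rfloor> / real (Suc m) \<le> s"
  proof (rule always_eventually, rule allI)
    fix m
    have "of_int \<lfloor>real (Suc m) * s\<rfloor> \<le> real (Suc m) * s" by linarith
    then show "of_int \<lfloor>real (Suc m) * s\<rfloor> / real (Suc m) \<le> s"
      by (simp add: field_simps del: of_nat_Suc)
  qed
qed simp

context synchronizing_particles
begin

section \<open>Sigma-algebras generated by groups of sources\<close>

definition source_events :: "source \<Rightarrow> 'a set set" where
  "source_events s = (case s of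
          Noise \<Rightarrow> generated_events M ({1..N} \<times> {0..}) borel (\<lambda>(k, t). B k t)
        | Epochs \<Rightarrow> generated_events M UNIV borel \<tau>
        | Initial \<Rightarrow> generated_events M {1..N} borel (\<lambda>k \<omega>. x 0 \<omega> k)
        | Pairs \<Rightarrow> generated_events M {1..} (count_space UNIV) p)"

text \<open>Measurability with respect to it expresses dependence on the sources in \<open>A\<close>
  alone. As its space is that of \<open>M\<close>, the identity map can serve as the random variable
  that reads these sources.\<close>

definition source_algebra :: "source set \<Rightarrow> 'a measure" where
  "source_algebra A = sigma (space M) (\<Union>s\<in>A. source_events s)"

lemma source_events_subset: "source_events s \<subseteq> events"
  using independent unfolding indep_sets_def source_events_def by blast

lemma space_source_algebra[simp]: "space (source_algebra A) = space M"
  unfolding source_algebra_def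
  using source_events_subset sets.space_closed by (intro space_measure_of) blast

lemma sets_source_algebra:
  "sets (source_algebra A) = sigma_sets (space M) (\<Union>s\<in>A. source_events s)"
  unfolding source_algebra_def
  using source_events_subset sets.space_closed by (intro sets_measure_of) blast

lemma sets_source_algebra_subset: "sets (source_algebra A) \<subseteq> events"
  unfolding sets_source_algebra using source_events_subset by (intro sets.sigma_sets_subset) blast

lemma measurable_source_algebra: "f \<in> measurable (source_algebra A) L \<Longrightarrow> f \<in> measurable M L"
  using sets_source_algebra_subset by (auto simp: measurable_def)

lemma indep_source_algebra:
  assumes "A \<inter> C = {}"
  shows "indep_var (source_algebra A) (\<lambda>\<omega>. \<omega>) (source_algebra C) (\<lambda>\<omega>. \<omega>)"
proof -
  \<comment> \<open>\<open>indep_var\<close> speaks of preimages, and under the identity map these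
    are the sets themselves.\<close>
  have pre: "sigma_sets (space M) {(\<lambda>\<omega>. \<omega>) -` X \<inter> space M |X. X \<in> sets (source_algebra D)}
      = sigma_sets (space M) (\<Union>s\<in>D. source_events s)" for D
  proof -
    have "{(\<lambda>\<omega>. \<omega>) -` X \<inter> space M |X. X \<in> sets (source_algebra D)} = sets (source_algebra D)"
      using sets.sets_into_space[of _ "source_algebra D"] by (auto simp: Int_absorb2)
    then show ?thesis
      using sets.sigma_sets_eq[of "source_algebra D"] by (simp add: sets_source_algebra)
  qed
  have "indep_sets (\<lambda>j. sigma_sets (space M) (\<Union>s\<in>case_bool A C j. source_events s)) UNIV"
  proof (rule indep_sets_collect_sigma)
    show "indep_sets source_events (\<Union>j. case_bool A C j)"
      using independent unfolding source_events_def by (rule indep_sets_mono_index[rotated]) auto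
    show "Int_stable (source_events s)" for s
      by (cases s) (simp_all add: source_events_def Int_stable_generated_events)
    show "disjoint_family (case_bool A C)"
      using assms by (auto simp: disjoint_family_on_def split: bool.split)
  qed
  also have "(\<lambda>j. sigma_sets (space M) (\<Union>s\<in>case_bool A C j. source_events s))
     = case_bool (sigma_sets (space M) (\<Union>s\<in>A. source_events s)) (sigma_sets (space M) (\<Union>s\<in>C. source_events s))"
    by (auto simp: fun_eq_iff split: bool.split)
  finally show ?thesis
    unfolding indep_var_eq pre indep_set_def
    using sets_source_algebra_subset by (auto simp: measurable_def sets.Int_space_eq2 dest: sets.sets_into_space)
qed

text \<open>With identity maps as the two variables, the first argument of \<open>f\<close> is read
  through the sources in \<open>A\<close> and the second through those in \<open>C\<close>, with no
  need to encode sources as values.\<close>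

lemma nn_integral_decouple:
  assumes "A \<inter> C = {}" "f \<in> borel_measurable (source_algebra A \<Otimes>\<^sub>M source_algebra C)"
  shows "(\<integral>\<^sup>+\<omega>. f (\<omega>, \<omega>) \<partial>M) = (\<integral>\<^sup>+\<omega>'. \<integral>\<^sup>+\<omega>. f (\<omega>', \<omega>) \<partial>M \<partial>M)"
  using nn_integral_indep_var[OF indep_source_algebra assms(2)] assms(1) by simp

lemma source_events_in_source_algebra: "s \<in> A \<Longrightarrow> source_events s \<subseteq> sets (source_algebra A)"
  unfolding sets_source_algebra by blast

lemma measurable_pairs:
  "Pairs \<in> A \<Longrightarrow> i \<ge> 1 \<Longrightarrow> p i \<in> measurable (source_algebra A) (count_space UNIV)"
  by (rule measurable_generated_events[of i "{1..}"])
    (use source_events_in_source_algebra[of Pairs A] in \<open>auto simp: source_events_def\<close>)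

lemma measurable_epochs: "Epochs \<in> A \<Longrightarrow> \<tau> i \<in> borel_measurable (source_algebra A)"
  by (rule measurable_generated_events[of i UNIV])
    (use source_events_in_source_algebra[of Epochs A] in \<open>auto simp: source_events_def\<close>)

lemma measurable_initial:
  "Initial \<in> A \<Longrightarrow> k \<in> {1..N} \<Longrightarrow> (\<lambda>\<omega>. x 0 \<omega> k) \<in> borel_measurable (source_algebra A)"
  by (rule measurable_generated_events[of k "{1..N}"])
    (use source_events_in_source_algebra[of Initial A] in \<open>auto simp: source_events_def\<close>)

lemma measurable_noise:
  "Noise \<in> A \<Longrightarrow> k \<in> {1..N} \<Longrightarrow> 0 \<le> s \<Longrightarrow> B k s \<in> borel_measurable (source_algebra A)"
  using measurable_generated_events[of "(k, s)" "{1..N} \<times> {0..}" M "\<lambda>(k, t). B k t" borel "source_algebra A"]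
    source_events_in_source_algebra[of Noise A] by (auto simp: source_events_def)

text \<open>A version of the Brownian motion that is jointly measurable in time and \<open>\<omega>\<close>, so that it may be
  evaluated at the random epochs; \<open>B\<close> itself is only continuous almost surely.\<close>

definition B' :: "nat \<Rightarrow> real \<Rightarrow> 'a \<Rightarrow> real" where
  "B' k s \<omega> = lim (\<lambda>m. B k (max 0 (of_int \<lfloor>real (Suc m) * s\<rfloor> / real (Suc m))) \<omega>)"

text \<open>The time \<open>f z\<close> and the sample point \<open>g z\<close> may come from
  different coordinates; this allows the path at \<omega> to be evaluated at the epochs of another
  point.\<close>

lemma measurable_B':
  assumes [measurable]: "f \<in> borel_measurable L" "g \<in> measurable L (source_algebra {Noise})"
    and k: "k \<in> {1..N}"
  shows "(\<lambda>z. B' k (f z) (g z)) \<in> borel_measurable L"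
  unfolding B'_def
proof (rule borel_measurable_lim_metric)
  fix m
  show "(\<lambda>z. B k (max 0 (of_int \<lfloor>real (Suc m) * f z\<rfloor> / real (Suc m))) (g z)) \<in> borel_measurable L"
  proof (rule measurable_compose_countable[where f = "\<lambda>i z. B k (max 0 (of_int i / real (Suc m))) (g z)"])
    fix i :: int
    \<comment> \<open>The cutoff at 0 keeps the time in the range where
      \<open>measurable_noise\<close> applies.\<close>
    show "(\<lambda>z. B k (max 0 (of_int i / real (Suc m))) (g z)) \<in> borel_measurable L"
      by (rule measurable_compose[OF assms(2) measurable_noise[OF _ k]]) auto
  qed measurable
qed

lemma B'_eq:
  assumes c: "continuous_on {0..} (\<lambda>t. B k t \<omega>)" and s: "0 \<le> s"
  shows "B' k s \<omega> = B k s \<omega>"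
  unfolding B'_def
proof (rule limI)
  have "(\<lambda>m. max 0 (of_int \<lfloor>real (Suc m) * s\<rfloor> / real (Suc m))) \<longlonglongrightarrow> max 0 s"
    by (intro tendsto_max tendsto_const tendsto_floor_grid)
  then show "(\<lambda>m. B k (max 0 (of_int \<lfloor>real (Suc m) * s\<rfloor> / real (Suc m))) \<omega>) \<longlonglongrightarrow> B k s \<omega>"
    using s by (intro continuous_on_tendsto_compose[OF c]) (auto simp: max_def)
qed

lemma AE_B'_eq: "AE \<omega> in M. \<forall>k\<in>{1..N}. \<forall>s\<ge>0. B' k s \<omega> = B k s \<omega>"
  using brownian_dim_continuous[OF brownian] by eventually_elim (auto intro: B'_eq)

text \<open>Times, pairs and initial configuration are frozen here. At fixed times the increments of
  \<open>B'\<close> and \<open>B\<close> agree almost surely, so the moments carry over and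
  \<open>chain_second_moment\<close> applies.\<close>

lemma noise_average:
  assumes u: "mono u" "0 \<le> u 0" and N: "N \<ge> 2"
  defines "\<xi> \<equiv> \<lambda>\<omega> i k. B' k (u (Suc i)) \<omega> - B' k (u i) \<omega>"
    and "h \<equiv> \<lambda>i. u (Suc i) - u i"
  shows "(\<integral>\<^sup>+\<omega>. ennreal (emp_var N (\<lambda>a. chain N \<sigma> \<pi> y (\<xi> \<omega>) n a + \<sigma> * \<xi> \<omega> n a)) \<partial>M)
    = ennreal (half_mean N (spread_step \<sigma> (h n) (gap N \<sigma> \<pi> y h n)))"
proof -
  have u0: "0 \<le> u i" for i using u monoD[OF u(1), of 0 i] by simp
  have u1: "u i \<le> u (Suc i)" for i using monoD[OF u(1)] by simp
  have B'm[measurable]: "B' k s \<in> borel_measurable M" if "k \<in> {1..N}" for k s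
    using measurable_source_algebra[OF measurable_B'[OF _ measurable_ident that, of "\<lambda>_. s"]] by simp
  have m: "(\<lambda>\<omega>. \<xi> \<omega> i k) \<in> borel_measurable M" if "k \<in> {1..N}" for i k
    using that unfolding \<xi>_def by measurable
  have Bm[measurable]: "B k (u i) \<in> borel_measurable M" if "k \<in> {1..N}" for k i
    using measurable_source_algebra[OF measurable_noise[OF _ that u0, of "{Noise}"]] by simp
  have eq: "AE \<omega> in M. \<forall>k\<in>{1..N}. \<forall>i. \<xi> \<omega> i k = B k (u (Suc i)) \<omega> - B k (u i) \<omega>"
    using AE_B'_eq by eventually_elim (simp add: \<xi>_def u0)
  have BM: "standard_brownian_motion (B k)" if "k \<in> {1..N}" for k
    using brownian that by (simp add: standard_brownian_motion_dim_def)
  note mom = brownian_increment_moments[OF BM u0 u1]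
  have hb: "has_bochner_integral M
      (\<lambda>\<omega>. ((chain N \<sigma> \<pi> y (\<xi> \<omega>) n a + \<sigma> * \<xi> \<omega> n a) - (chain N \<sigma> \<pi> y (\<xi> \<omega>) n b + \<sigma> * \<xi> \<omega> n b))\<^sup>2)
      (spread_step \<sigma> (h n) (gap N \<sigma> \<pi> y h n) a b)" if "a \<in> {1..N}" "b \<in> {1..N}" for a b
  proof (rule chain_second_moment[of N "\<lambda>i k \<omega>. \<xi> \<omega> i k", OF _ _ _ _ _ that])
    fix i k assume k: "k \<in> {1..N}"
    show "(\<lambda>\<omega>. \<xi> \<omega> i k) \<in> borel_measurable M" by (rule m[OF k])
    have e: "AE \<omega> in M. \<xi> \<omega> i k = B k (u (Suc i)) \<omega> - B k (u i) \<omega>"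
      using eq k by auto
    have e2: "AE \<omega> in M. (\<xi> \<omega> i k)\<^sup>2 = (B k (u (Suc i)) \<omega> - B k (u i) \<omega>)\<^sup>2"
      using e by auto
    note [measurable] = m[OF k] Bm[OF k]
    show "integrable M (\<lambda>\<omega>. (\<xi> \<omega> i k)\<^sup>2)"
      using mom(1)[OF k] by (subst integrable_cong_AE[OF _ _ e2]) auto
    show "expectation (\<lambda>\<omega>. \<xi> \<omega> i k) = 0"
      using mom(4)[OF k] by (subst integral_cong_AE[OF _ _ e]) auto
    show "expectation (\<lambda>\<omega>. (\<xi> \<omega> i k)\<^sup>2) = h i"
      using mom(2)[OF k] by (subst integral_cong_AE[OF _ _ e2]) (auto simp: h_def)
    fix j l assume l: "l \<in> {1..N}" and ne: "i \<noteq> j \<or> k \<noteq> l"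
    note [measurable] = m[OF l] Bm[OF l]
    have e3: "AE \<omega> in M. \<xi> \<omega> i k * \<xi> \<omega> j l
        = (B k (u (Suc i)) \<omega> - B k (u i) \<omega>) * (B l (u (Suc j)) \<omega> - B l (u j) \<omega>)"
      using eq k l by auto
    show "expectation (\<lambda>\<omega>. \<xi> \<omega> i k * \<xi> \<omega> j l) = 0"
      using brownian_increments_orthogonal[OF brownian u k l ne]
      by (subst integral_cong_AE[OF _ _ e3]) auto
  qed
  define v where "v \<omega> = emp_var N (\<lambda>a. chain N \<sigma> \<pi> y (\<xi> \<omega>) n a + \<sigma> * \<xi> \<omega> n a)" for \<omega>
  have "has_bochner_integral M v (half_mean N (spread_step \<sigma> (h n) (gap N \<sigma> \<pi> y h n)))"
    unfolding v_def emp_var_eq_half_mean[OF N] half_mean_def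
    by (intro has_bochner_integral_divide has_bochner_integral_sum hb)
  moreover have "0 \<le> v \<omega>" for \<omega>
    unfolding v_def emp_var_eq_half_mean[OF N] by (rule half_mean_nonneg) (use N in auto)
  ultimately show ?thesis
    unfolding v_def[symmetric] by (subst nn_integral_eq_integral) (auto simp: has_bochner_integral_iff)
qed

lemma nn_integral_pair:
  assumes "i \<ge> 1" and N: "N \<ge> 2" and g: "\<And>q. 0 \<le> g q"
  shows "(\<integral>\<^sup>+\<omega>. ennreal (g (p i \<omega>)) \<partial>M) = ennreal ((\<Sum>q\<in>index_pairs N. g q) / (real N * (real N - 1)))"
proof -
  have ne: "index_pairs N \<noteq> {}"
    using card_index_pairs[of N] N by (auto simp del: of_nat_eq_0_iff)
  have d: "distr M (count_space UNIV) (p i) = measure_pmf (pmf_of_set (index_pairs N))"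
    using pairs assms(1) by (simp add: uniform_pair_sequence_def index_pairs_def)
  have [measurable]: "p i \<in> measurable M (count_space UNIV)"
    using measurable_source_algebra[OF measurable_pairs[of "{Pairs}"]] assms(1) by simp
  have "(\<integral>\<^sup>+\<omega>. ennreal (g (p i \<omega>)) \<partial>M) = (\<integral>\<^sup>+q. ennreal (g q) \<partial>distr M (count_space UNIV) (p i))"
    by (subst nn_integral_distr) auto
  also have "\<dots> = (\<Sum>q\<in>index_pairs N. ennreal (g q)) / card (index_pairs N)"
    unfolding d by (rule nn_integral_pmf_of_set[OF ne finite_index_pairs])
  also have "\<dots> = ennreal ((\<Sum>q\<in>index_pairs N. g q) / real (card (index_pairs N)))"
    using ne g finite_index_pairs[of N]
    by (subst sum_ennreal) (auto simp: ennreal_of_nat_eq_real_of_nat divide_ennreal sum_nonneg card_gt_0_iff)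
  finally show ?thesis by (simp add: card_index_pairs)
qed

lemma AE_index_pairs:
  assumes N: "N \<ge> 2"
  shows "AE \<omega> in M. \<forall>i\<ge>1. p i \<omega> \<in> index_pairs N"
proof -
  have "AE \<omega> in M. p i \<omega> \<in> index_pairs N" if i: "i \<ge> 1" for i
  proof -
    have [measurable]: "p i \<in> measurable M (count_space UNIV)"
      using measurable_source_algebra[OF measurable_pairs[of "{Pairs}"]] i by simp
    \<comment> \<open>The uniform average of the indicator of the complement is zero.\<close>
    have "(\<integral>\<^sup>+\<omega>. ennreal (indicator (- index_pairs N) (p i \<omega>)) \<partial>M) = 0"
      by (subst nn_integral_pair[OF i N]) auto
    then show ?thesis
      by (subst (asm) nn_integral_0_iff_AE) (auto simp: indicator_def split: if_splits)
  qed
  then show ?thesis by (intro AE_all_countable[THEN iffD2] allI) (auto intro: AE_impI)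
qed

text \<open>The table \<open>D\<close> depends on the first \<open>n\<close> pairs, of which the
  next pair is independent. Averaging over that pair returns a multiple of \<open>half_mean\<close>
  of \<open>D\<close> by \<open>sum_half_mean_copy_index\<close>, so the induction closes on one
  number.\<close>

lemma pairs_average_gap:
  assumes N: "N \<ge> 2" and h: "\<And>i. 0 \<le> h i"
  shows "(\<integral>\<^sup>+\<omega>. ennreal (half_mean N (gap N \<sigma> (\<lambda>i. p i \<omega>) y h n)) \<partial>M)
     = ennreal (post (1 - 2 / (real N * (real N - 1))) \<sigma> (emp_var N y) h n)"
proof (induction n)
  case 0
  then show ?case by (simp add: emp_var_eq_half_mean[OF N] emeasure_space_1)
next
  case (Suc n)
  define c where "c = real N * (real N - 1)"
  have "2 * 1 \<le> c" unfolding c_def using N by (intro mult_mono) auto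
  then have c: "c \<ge> 2" by simp
  have r: "0 \<le> 1 - 2 / c" using c by simp
  define D where "D \<pi> = spread_step \<sigma> (h n) (gap N \<sigma> \<pi> y h n)" for \<pi>
  define g where "g \<pi> q = half_mean N (\<lambda>a b. D \<pi> (copy_index N q a) (copy_index N q b))" for \<pi> q
  have D0: "0 \<le> D \<pi> a b" "D \<pi> a a = 0" for \<pi> a b
    unfolding D_def spread_step_def using h gap_nonneg[of n h] by (auto simp: gap_same)
  have g0: "0 \<le> g \<pi> q" for \<pi> q unfolding g_def using N D0 by (intro half_mean_nonneg) auto
  have hm0: "0 \<le> half_mean N (gap N \<sigma> \<pi> y h n)" for \<pi>
    using N h by (intro half_mean_nonneg gap_nonneg) auto
  let ?P = "PiM {1..n} (\<lambda>_. count_space UNIV :: (nat \<times> nat) measure)"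
  let ?Q = "PiM {Suc n} (\<lambda>_. count_space UNIV :: (nat \<times> nat) measure)"
  \<comment> \<open>Independence is available for tuples restricted to \<open>{1..n}\<close> and
    \<open>{Suc n}\<close>, hence a function of such tuples; \<open>D_cong\<close> undoes the
    restriction.\<close>
  define f where "f = (\<lambda>(\<pi>, q). ennreal (g \<pi> (q (Suc n))))"
  have f: "f \<in> borel_measurable (?P \<Otimes>\<^sub>M ?Q)"
  proof -
    have q: "(\<lambda>z. snd z (Suc n)) \<in> measurable (?P \<Otimes>\<^sub>M ?Q) (count_space UNIV)" by measurable
    have "(\<lambda>z. D (fst z) (copy_index N (snd z (Suc n)) a) (copy_index N (snd z (Suc n)) b))
      \<in> borel_measurable (?P \<Otimes>\<^sub>M ?Q)" if "a \<in> {1..N}" "b \<in> {1..N}" for a b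
    proof (rule measurable_copy_index[OF _ q that(2)], rule measurable_copy_index[OF _ q that(1)])
      fix c d assume cd: "c \<in> {1..N}" "d \<in> {1..N}"
      have [measurable]: "(\<lambda>z. gap N \<sigma> (fst z) y h n d c) \<in> borel_measurable (?P \<Otimes>\<^sub>M ?Q)"
        using cd by (intro measurable_gap) (auto intro!: measurable_compose[OF measurable_fst])
      show "(\<lambda>z. D (fst z) d c) \<in> borel_measurable (?P \<Otimes>\<^sub>M ?Q)"
        unfolding D_def spread_step_def by measurable
    qed
    then have "(\<lambda>z. ennreal (g (fst z) (snd z (Suc n)))) \<in> borel_measurable (?P \<Otimes>\<^sub>M ?Q)"
      unfolding g_def half_mean_def
      by (intro measurable_compose[OF _ measurable_ennreal] borel_measurable_divide borel_measurable_sum) auto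
    then show ?thesis by (simp add: f_def split_def)
  qed
  have ind: "indep_vars (\<lambda>_. count_space UNIV) p {1..}"
    using pairs by (simp add: uniform_pair_sequence_def)
  have D_cong: "D (restrict (\<lambda>i. p i \<omega>) {1..n}) = D (\<lambda>i. p i \<omega>)" for \<omega>
  proof -
    have "gap N \<sigma> (restrict (\<lambda>i. p i \<omega>) {1..n}) y h n a b = gap N \<sigma> (\<lambda>i. p i \<omega>) y h n a b" for a b
      by (rule gap_cong) simp
    then show ?thesis unfolding D_def spread_step_def by (simp add: fun_eq_iff)
  qed
  have f_eq: "f (restrict (\<lambda>i. p i \<omega>') {1..n}, restrict (\<lambda>i. p i \<omega>) {Suc n}) = ennreal (g (\<lambda>i. p i \<omega>') (p (Suc n) \<omega>))"
    for \<omega>' \<omega>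
    unfolding f_def prod.case g_def D_cong by simp
  have "(\<integral>\<^sup>+\<omega>. ennreal (half_mean N (gap N \<sigma> (\<lambda>i. p i \<omega>) y h (Suc n))) \<partial>M)
      = (\<integral>\<^sup>+\<omega>. f (restrict (\<lambda>i. p i \<omega>) {1..n}, restrict (\<lambda>i. p i \<omega>) {Suc n}) \<partial>M)"
    unfolding f_eq by (simp add: g_def D_def half_mean_def)
  also have "\<dots> = (\<integral>\<^sup>+\<omega>'. \<integral>\<^sup>+\<omega>. ennreal (g (\<lambda>i. p i \<omega>') (p (Suc n) \<omega>)) \<partial>M \<partial>M)"
    by (subst nn_integral_indep_var[OF indep_var_restrict[OF ind] f]) (auto simp only: f_eq, auto)
  also have "\<dots> = (\<integral>\<^sup>+\<omega>'. ennreal ((1 - 2 / c) * (half_mean N (gap N \<sigma> (\<lambda>i. p i \<omega>') y h n) + \<sigma>\<^sup>2 * h n)) \<partial>M)"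
  proof (rule nn_integral_cong)
    fix \<omega>'
    have "(\<integral>\<^sup>+\<omega>. ennreal (g (\<lambda>i. p i \<omega>') (p (Suc n) \<omega>)) \<partial>M)
        = ennreal ((\<Sum>q\<in>index_pairs N. g (\<lambda>i. p i \<omega>') q) / c)"
      unfolding c_def by (rule nn_integral_pair[OF _ N g0]) simp
    also have "(\<Sum>q\<in>index_pairs N. g (\<lambda>i. p i \<omega>') q) = c * (1 - 2 / c) * half_mean N (D (\<lambda>i. p i \<omega>'))"
      unfolding g_def c_def by (rule sum_half_mean_copy_index[OF D0(2) N])
    finally show "(\<integral>\<^sup>+\<omega>. ennreal (g (\<lambda>i. p i \<omega>') (p (Suc n) \<omega>)) \<partial>M)
        = ennreal ((1 - 2 / c) * (half_mean N (gap N \<sigma> (\<lambda>i. p i \<omega>') y h n) + \<sigma>\<^sup>2 * h n))"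
      using c by (simp add: D_def half_mean_spread_step[OF N])
  qed
  also have "\<dots> = (\<integral>\<^sup>+\<omega>'. ennreal (1 - 2 / c) * (ennreal (half_mean N (gap N \<sigma> (\<lambda>i. p i \<omega>') y h n)) + ennreal (\<sigma>\<^sup>2 * h n)) \<partial>M)"
    using r h hm0 by (simp add: ennreal_mult)
  also have "\<dots> = ennreal (1 - 2 / c) * ((\<integral>\<^sup>+\<omega>'. ennreal (half_mean N (gap N \<sigma> (\<lambda>i. p i \<omega>') y h n)) \<partial>M) + ennreal (\<sigma>\<^sup>2 * h n))"
  proof -
    have [measurable]: "(\<lambda>\<omega>. gap N \<sigma> (\<lambda>i. p i \<omega>) y h n a b) \<in> borel_measurable M" if "a \<in> {1..N}" "b \<in> {1..N}" for a b
      using that measurable_source_algebra[OF measurable_pairs[of "{Pairs}"]] by (intro measurable_gap) auto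
    have [measurable]: "(\<lambda>\<omega>. half_mean N (gap N \<sigma> (\<lambda>i. p i \<omega>) y h n)) \<in> borel_measurable M"
      unfolding half_mean_def by (intro borel_measurable_divide borel_measurable_sum) auto
    show ?thesis
      by (subst nn_integral_cmult, measurable) (subst nn_integral_add, auto simp: emeasure_space_1)
  qed
  also have "\<dots> = ennreal ((1 - 2 / c) * (post (1 - 2 / c) \<sigma> (emp_var N y) h n + \<sigma>\<^sup>2 * h n))"
  proof -
    have "0 \<le> emp_var N y"
      unfolding emp_var_eq_half_mean[OF N] by (rule half_mean_nonneg) (use N in auto)
    then have "0 \<le> post (1 - 2 / c) \<sigma> (emp_var N y) h n" using r h by (intro post_nonneg) auto
    then show ?thesis unfolding Suc.IH c_def[symmetric] using r h by (simp add: ennreal_mult)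
  qed
  finally show ?case by (simp only: c_def post.simps)
qed

end

subsection \<open>Averaging over the sources\<close>

context synchronizing_particles
begin

text \<open>Cutting the epochs off at \<open>t\<close> ends the flight in progress there. On the
  window of index \<open>n\<close> the configuration at \<open>t\<close> is then the end of flight
  \<open>n\<close>, of the same form as any complete flight.\<close>

definition stopped :: "real \<Rightarrow> 'a \<Rightarrow> nat \<Rightarrow> real" where
  "stopped t \<omega> i = min (\<tau> i \<omega>) t"

definition holding :: "real \<Rightarrow> 'a \<Rightarrow> nat \<Rightarrow> real" where
  "holding t \<omega> i = stopped t \<omega> (Suc i) - stopped t \<omega> i"

text \<open>Below, \<open>\<omega>'\<close> carries the epochs, the initial configuration and the pairs, and \<open>\<omega>\<close> the Brownian
  motion; the process itself is the diagonal \<open>\<omega>' = \<omega>\<close>.\<close>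

definition noise :: "real \<Rightarrow> 'a \<Rightarrow> 'a \<Rightarrow> nat \<Rightarrow> nat \<Rightarrow> real" where
  "noise t \<omega>' \<omega> i k = B' k (stopped t \<omega>' (Suc i)) \<omega> - B' k (stopped t \<omega>' i) \<omega>"

definition position :: "real \<Rightarrow> nat \<Rightarrow> 'a \<Rightarrow> 'a \<Rightarrow> nat \<Rightarrow> real" where
  "position t n \<omega>' \<omega> a =
     chain N \<sigma> (\<lambda>i. p i \<omega>') (x 0 \<omega>') (noise t \<omega>' \<omega>) n a + \<sigma> * noise t \<omega>' \<omega> n a"

definition epoch_window :: "real \<Rightarrow> nat \<Rightarrow> 'a set" where
  "epoch_window t n = {\<omega>. \<tau> n \<omega> \<le> t \<and> t < \<tau> (Suc n) \<omega>}"

lemma AE_epochs: "AE \<omega> in M. \<tau> 0 \<omega> = 0 \<and> (\<forall>n. \<tau> n \<omega> < \<tau> (Suc n) \<omega>)"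
  using epochs by (simp add: poisson_epochs_def)

text \<open>Pathwise induction over the epochs. The left limit at the next epoch is computed twice,
  from free motion by continuity of the Brownian path and from the jump rules; uniqueness of limits
  identifies the configuration after the jump.\<close>

lemma AE_position:
  assumes N: "N \<ge> 2"
  shows "AE \<omega> in M. \<forall>n. \<omega> \<in> epoch_window t n \<longrightarrow> (\<forall>a\<in>{1..N}. x t \<omega> a = position t n \<omega> \<omega> a)"
  using AE_epochs AE_B'_eq brownian_dim_continuous[OF brownian] free_motion jump_copy jump_stay
    AE_index_pairs[OF N]
proof eventually_elim
  fix \<omega>
  assume "\<tau> 0 \<omega> = 0 \<and> (\<forall>n. \<tau> n \<omega> < \<tau> (Suc n) \<omega>)"
    and B': "\<forall>k\<in>{1..N}. \<forall>s\<ge>0. B' k s \<omega> = B k s \<omega>"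
    and cont: "\<forall>k\<in>{1..N}. continuous_on {0..} (\<lambda>t. B k t \<omega>)"
    and free: "\<forall>n. \<forall>s\<in>{\<tau> n \<omega>..<\<tau> (Suc n) \<omega>}. \<forall>k\<in>{1..N}.
          x s \<omega> k - x (\<tau> n \<omega>) \<omega> k = \<sigma> * (B k s \<omega> - B k (\<tau> n \<omega>) \<omega>)"
    and copy: "\<forall>n\<ge>1. ((\<lambda>s. x s \<omega> (fst (p n \<omega>))) \<longlongrightarrow> x (\<tau> n \<omega>) \<omega> (snd (p n \<omega>))) (at_left (\<tau> n \<omega>))"
    and stay: "\<forall>n\<ge>1. \<forall>m\<in>{1..N} - {snd (p n \<omega>)}.
          ((\<lambda>s. x s \<omega> m) \<longlongrightarrow> x (\<tau> n \<omega>) \<omega> m) (at_left (\<tau> n \<omega>))"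
    and p: "\<forall>i\<ge>1. p i \<omega> \<in> index_pairs N"
  then have \<tau>0: "\<tau> 0 \<omega> = 0" and \<tau>: "\<And>n. \<tau> n \<omega> < \<tau> (Suc n) \<omega>" by auto
  have \<tau>_nonneg: "0 \<le> \<tau> n \<omega>" for n
    by (induction n) (use \<tau>0 \<tau> in \<open>auto intro: order_trans less_imp_le\<close>)
  let ?X = "chain N \<sigma> (\<lambda>i. p i \<omega>) (x 0 \<omega>) (noise t \<omega> \<omega>)"
  have X: "\<tau> n \<omega> \<le> t \<Longrightarrow> a \<in> {1..N} \<Longrightarrow> x (\<tau> n \<omega>) \<omega> a = ?X n a" for n a
  proof (induction n arbitrary: a)
    case 0
    then show ?case by (simp add: \<tau>0)
  next
    case (Suc n)
    let ?T = "\<tau> (Suc n) \<omega>"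
    have le: "\<tau> n \<omega> \<le> t" using \<tau>[of n] Suc.prems by simp
    define c where "c = copy_index N (p (Suc n) \<omega>) a"
    have c: "c \<in> {1..N}" using copy_index_in Suc.prems by (simp add: c_def)
    have T: "?T > 0" using \<tau>[of n] \<tau>_nonneg[of n] by simp
    have "isCont (\<lambda>s. B c s \<omega>) ?T"
    proof -
      have "continuous_on {0<..} (\<lambda>s. B c s \<omega>)"
        by (rule continuous_on_subset[OF cont[rule_format, OF c]]) auto
      then show ?thesis using T by (simp add: continuous_on_eq_continuous_at)
    qed
    then have "((\<lambda>s. B c s \<omega>) \<longlongrightarrow> B c ?T \<omega>) (at_left ?T)"
      unfolding isCont_def by (rule filterlim_mono[OF _ order_refl at_le]) simp
    then have "((\<lambda>s. ?X n c + \<sigma> * (B c s \<omega> - B c (\<tau> n \<omega>) \<omega>)) \<longlongrightarrow>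
        ?X n c + \<sigma> * (B c ?T \<omega> - B c (\<tau> n \<omega>) \<omega>)) (at_left ?T)"
      by (intro tendsto_intros)
    moreover have "\<forall>\<^sub>F s in at_left ?T. ?X n c + \<sigma> * (B c s \<omega> - B c (\<tau> n \<omega>) \<omega>) = x s \<omega> c"
    proof -
      have "?X n c + \<sigma> * (B c s \<omega> - B c (\<tau> n \<omega>) \<omega>) = x s \<omega> c" if "\<tau> n \<omega> < s" "s < ?T" for s
        using free[rule_format, of s n c] Suc.IH[OF le c] that c by simp
      then show ?thesis using \<tau>[of n] by (subst eventually_at_left) auto
    qed
    ultimately have 1: "((\<lambda>s. x s \<omega> c) \<longlongrightarrow> ?X n c + \<sigma> * (B c ?T \<omega> - B c (\<tau> n \<omega>) \<omega>)) (at_left ?T)"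
      by (rule Lim_transform_eventually)
    have 2: "((\<lambda>s. x s \<omega> c) \<longlongrightarrow> x ?T \<omega> a) (at_left ?T)"
    proof (cases "a = snd (p (Suc n) \<omega>)")
      case True
      then have "c = fst (p (Suc n) \<omega>)"
        using p[rule_format, of "Suc n"] by (auto simp: c_def copy_index_def index_pairs_def)
      then show ?thesis using copy[rule_format, of "Suc n"] True by simp
    next
      case False
      then have "c = a" by (simp add: c_def copy_index_def)
      then show ?thesis using stay[rule_format, of "Suc n" a] False Suc.prems by simp
    qed
    have "x ?T \<omega> a = ?X n c + \<sigma> * (B c ?T \<omega> - B c (\<tau> n \<omega>) \<omega>)"
      by (rule tendsto_unique[OF _ 2 1]) simp
    \<comment> \<open>Both epochs are at most \<open>t\<close>, so the cutoff leaves them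
      unchanged.\<close>
    also have "B c ?T \<omega> - B c (\<tau> n \<omega>) \<omega> = noise t \<omega> \<omega> n c"
      using B' c \<tau>_nonneg le Suc.prems by (simp add: noise_def stopped_def min_absorb1)
    finally show ?case by (simp add: c_def Let_def)
  qed
  show "\<forall>n. \<omega> \<in> epoch_window t n \<longrightarrow> (\<forall>a\<in>{1..N}. x t \<omega> a = position t n \<omega> \<omega> a)"
  proof (intro allI impI ballI)
    fix n a assume "\<omega> \<in> epoch_window t n" and a: "a \<in> {1..N}"
    then have w: "\<tau> n \<omega> \<le> t" "t < \<tau> (Suc n) \<omega>" by (auto simp: epoch_window_def)
    then have "0 \<le> t" using \<tau>_nonneg[of n] by simp
    then have "noise t \<omega> \<omega> n a = B a t \<omega> - B a (\<tau> n \<omega>) \<omega>"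
      using B' a \<tau>_nonneg w by (simp add: noise_def stopped_def min_absorb1 min_absorb2)
    then show "x t \<omega> a = position t n \<omega> \<omega> a"
      using free[rule_format, of t n a] X[OF w(1) a] w a by (simp add: position_def)
  qed
qed

lemma measurable_stopped: "Epochs \<in> A \<Longrightarrow> (\<lambda>\<omega>. stopped t \<omega> i) \<in> borel_measurable (source_algebra A)"
  unfolding stopped_def using measurable_epochs[of A i] by measurable

lemma measurable_holding: "Epochs \<in> A \<Longrightarrow> (\<lambda>\<omega>. holding t \<omega> i) \<in> borel_measurable (source_algebra A)"
  unfolding holding_def by (intro borel_measurable_diff measurable_stopped)

lemma measurable_epoch_window:
  assumes "Epochs \<in> A"
  shows "(indicator (epoch_window t n) :: 'a \<Rightarrow> ennreal) \<in> borel_measurable (source_algebra A)"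
proof -
  have [measurable]: "\<tau> i \<in> borel_measurable (source_algebra A)" for i by (rule measurable_epochs[OF assms])
  have "indicator (epoch_window t n) = (\<lambda>\<omega>. if \<tau> n \<omega> \<le> t \<and> t < \<tau> (Suc n) \<omega> then 1 else (0::ennreal))"
    by (auto simp: epoch_window_def indicator_def)
  also have "\<dots> \<in> borel_measurable (source_algebra A)" by measurable
  finally show ?thesis .
qed

lemma measurable_emp_var:
  assumes "\<And>a. a \<in> {1..N} \<Longrightarrow> (\<lambda>z. f z a) \<in> borel_measurable L"
  shows "(\<lambda>z. ennreal (emp_var N (f z))) \<in> borel_measurable L"
proof -
  have "(\<lambda>z. emp_mean N (f z)) \<in> borel_measurable L"
    unfolding emp_mean_def using assms by (intro borel_measurable_divide borel_measurable_sum) auto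
  then show ?thesis
    unfolding emp_var_def using assms
    by (intro measurable_compose[OF _ measurable_ennreal] borel_measurable_divide borel_measurable_sum
        borel_measurable_power borel_measurable_diff) auto
qed

lemma window_noise_average:
  assumes N: "N \<ge> 2" and t: "t \<ge> 0"
  shows "(\<integral>\<^sup>+\<omega>. indicator (epoch_window t n) \<omega> * ennreal (emp_var N (x t \<omega>)) \<partial>M)
    = (\<integral>\<^sup>+\<omega>. indicator (epoch_window t n) \<omega> *
        ennreal (half_mean N (spread_step \<sigma> (holding t \<omega> n) (gap N \<sigma> (\<lambda>i. p i \<omega>) (x 0 \<omega>) (holding t \<omega>) n))) \<partial>M)"
proof -
  let ?A = "{Epochs, Initial, Pairs}"
  let ?L = "source_algebra ?A \<Otimes>\<^sub>M source_algebra {Noise}"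
  define f where "f = (\<lambda>(\<omega>', \<omega>). indicator (epoch_window t n) \<omega>' * ennreal (emp_var N (position t n \<omega>' \<omega>)))"
  have f: "f \<in> borel_measurable ?L"
  proof -
    have noise: "(\<lambda>z. noise t (fst z) (snd z) i k) \<in> borel_measurable ?L" if "k \<in> {1..N}" for i k
      unfolding noise_def
      by (intro borel_measurable_diff measurable_B' that measurable_snd measurable_compose[OF measurable_fst]
          measurable_stopped) auto
    have "(\<lambda>z. position t n (fst z) (snd z) a) \<in> borel_measurable ?L" if "a \<in> {1..N}" for a
      unfolding position_def
      by (intro borel_measurable_add borel_measurable_times borel_measurable_const noise that measurable_chain)
        (auto intro!: measurable_compose[OF measurable_fst] measurable_pairs measurable_initial noise)
    then show ?thesis
      unfolding f_def split_def
      by (intro borel_measurable_times_ennreal measurable_compose[OF measurable_fst measurable_epoch_window]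
          measurable_emp_var) auto
  qed
  have "(\<integral>\<^sup>+\<omega>. indicator (epoch_window t n) \<omega> * ennreal (emp_var N (x t \<omega>)) \<partial>M) = (\<integral>\<^sup>+\<omega>. f (\<omega>, \<omega>) \<partial>M)"
  proof (rule nn_integral_cong_AE, use AE_position[OF N, of t] in eventually_elim)
    fix \<omega> assume *: "\<forall>n. \<omega> \<in> epoch_window t n \<longrightarrow> (\<forall>a\<in>{1..N}. x t \<omega> a = position t n \<omega> \<omega> a)"
    have "emp_var N (x t \<omega>) = emp_var N (position t n \<omega> \<omega>)" if "\<omega> \<in> epoch_window t n"
      unfolding emp_var_eq_half_mean[OF N] half_mean_def using * that by simp
    then show "indicator (epoch_window t n) \<omega> * ennreal (emp_var N (x t \<omega>)) = f (\<omega>, \<omega>)"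
      by (auto simp: f_def indicator_def)
  qed
  also have "\<dots> = (\<integral>\<^sup>+\<omega>'. \<integral>\<^sup>+\<omega>. f (\<omega>', \<omega>) \<partial>M \<partial>M)"
    by (rule nn_integral_decouple[OF _ f]) simp
  also have "\<dots> = (\<integral>\<^sup>+\<omega>. indicator (epoch_window t n) \<omega> *
        ennreal (half_mean N (spread_step \<sigma> (holding t \<omega> n) (gap N \<sigma> (\<lambda>i. p i \<omega>) (x 0 \<omega>) (holding t \<omega>) n))) \<partial>M)"
  proof (rule nn_integral_cong_AE, use AE_epochs in eventually_elim)
    fix \<omega>' assume \<tau>: "\<tau> 0 \<omega>' = 0 \<and> (\<forall>n. \<tau> n \<omega>' < \<tau> (Suc n) \<omega>')"
    have "mono (stopped t \<omega>')"
      by (intro incseq_SucI) (use \<tau> in \<open>auto simp: stopped_def less_imp_le intro!: min.coboundedI1\<close>)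
    moreover have "0 \<le> stopped t \<omega>' 0" using \<tau> t by (simp add: stopped_def)
    ultimately have "(\<integral>\<^sup>+\<omega>. ennreal (emp_var N (position t n \<omega>' \<omega>)) \<partial>M) =
       ennreal (half_mean N (spread_step \<sigma> (holding t \<omega>' n) (gap N \<sigma> (\<lambda>i. p i \<omega>') (x 0 \<omega>') (holding t \<omega>') n)))"
      using noise_average[OF _ _ N, of "stopped t \<omega>'" "\<lambda>i. p i \<omega>'" "x 0 \<omega>'" n]
      unfolding position_def noise_def holding_def by simp
    then show "(\<integral>\<^sup>+\<omega>. f (\<omega>', \<omega>) \<partial>M) = indicator (epoch_window t n) \<omega>' *
        ennreal (half_mean N (spread_step \<sigma> (holding t \<omega>' n) (gap N \<sigma> (\<lambda>i. p i \<omega>') (x 0 \<omega>') (holding t \<omega>') n)))"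
      by (auto simp: f_def indicator_def)
  qed
  finally show ?thesis .
qed

lemma holding_nonneg: "\<forall>n. \<tau> n \<omega> < \<tau> (Suc n) \<omega> \<Longrightarrow> 0 \<le> holding t \<omega> i"
  by (auto simp: holding_def stopped_def min_def dest: spec[of _ i])

text \<open>The second decoupling: with the noise averaged out, the pairs enter through
  \<open>gap\<close> only.\<close>

lemma window_pairs_average:
  assumes N: "N \<ge> 2" and t: "t \<ge> 0"
  shows "(\<integral>\<^sup>+\<omega>. indicator (epoch_window t n) \<omega> *
        ennreal (half_mean N (spread_step \<sigma> (holding t \<omega> n) (gap N \<sigma> (\<lambda>i. p i \<omega>) (x 0 \<omega>) (holding t \<omega>) n))) \<partial>M)
    = (\<integral>\<^sup>+\<omega>. indicator (epoch_window t n) \<omega> *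
        ennreal (post (1 - 2 / (real N * (real N - 1))) \<sigma> (emp_var N (x 0 \<omega>)) (holding t \<omega>) n + \<sigma>\<^sup>2 * holding t \<omega> n) \<partial>M)"
proof -
  let ?A = "{Epochs, Initial}"
  let ?L = "source_algebra ?A \<Otimes>\<^sub>M source_algebra {Pairs}"
  define f where "f = (\<lambda>(\<omega>', \<omega>). indicator (epoch_window t n) \<omega>' *
     ennreal (half_mean N (spread_step \<sigma> (holding t \<omega>' n) (gap N \<sigma> (\<lambda>i. p i \<omega>) (x 0 \<omega>') (holding t \<omega>') n))))"
  have f: "f \<in> borel_measurable ?L"
  proof -
    have h: "(\<lambda>z. holding t (fst z) i) \<in> borel_measurable ?L" for i
      by (intro measurable_compose[OF measurable_fst measurable_holding]) auto
    have "(\<lambda>z. spread_step \<sigma> (holding t (fst z) n) (gap N \<sigma> (\<lambda>i. p i (snd z)) (x 0 (fst z)) (holding t (fst z)) n) a b)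
       \<in> borel_measurable ?L" if "a \<in> {1..N}" "b \<in> {1..N}" for a b
    proof -
      have [measurable]: "(\<lambda>z. gap N \<sigma> (\<lambda>i. p i (snd z)) (x 0 (fst z)) (holding t (fst z)) n a b) \<in> borel_measurable ?L"
        by (rule measurable_gap[OF _ _ h that])
          (auto intro!: measurable_compose[OF measurable_fst] measurable_compose[OF measurable_snd] measurable_pairs measurable_initial)
      note [measurable] = h[of n]
      show ?thesis unfolding spread_step_def by measurable
    qed
    then show ?thesis
      unfolding f_def split_def half_mean_def
      by (intro borel_measurable_times_ennreal measurable_compose[OF measurable_fst measurable_epoch_window]
          measurable_compose[OF _ measurable_ennreal] borel_measurable_divide borel_measurable_sum) auto
  qed
  have "(\<integral>\<^sup>+\<omega>. f (\<omega>, \<omega>) \<partial>M) = (\<integral>\<^sup>+\<omega>'. \<integral>\<^sup>+\<omega>. f (\<omega>', \<omega>) \<partial>M \<partial>M)"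
    by (rule nn_integral_decouple[OF _ f]) simp
  also have "\<dots> = (\<integral>\<^sup>+\<omega>. indicator (epoch_window t n) \<omega> *
        ennreal (post (1 - 2 / (real N * (real N - 1))) \<sigma> (emp_var N (x 0 \<omega>)) (holding t \<omega>) n + \<sigma>\<^sup>2 * holding t \<omega> n) \<partial>M)"
  proof (rule nn_integral_cong_AE, use AE_epochs in eventually_elim)
    fix \<omega>' assume \<tau>: "\<tau> 0 \<omega>' = 0 \<and> (\<forall>n. \<tau> n \<omega>' < \<tau> (Suc n) \<omega>')"
    let ?h = "holding t \<omega>'" and ?y = "x 0 \<omega>'"
    have h: "0 \<le> ?h i" for i using \<tau> holding_nonneg by blast
    have "2 * 1 \<le> real N * (real N - 1)" using N by (intro mult_mono) auto
    then have "0 \<le> post (1 - 2 / (real N * (real N - 1))) \<sigma> (emp_var N ?y) ?h n"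
      using h by (intro post_nonneg) (auto simp: emp_var_eq_half_mean[OF N] intro!: half_mean_nonneg N)
    moreover have "0 \<le> half_mean N (gap N \<sigma> (\<lambda>i. p i \<omega>) ?y ?h n)" for \<omega>
      using N h by (intro half_mean_nonneg gap_nonneg) auto
    moreover have [measurable]: "(\<lambda>\<omega>. half_mean N (gap N \<sigma> (\<lambda>i. p i \<omega>) ?y ?h n)) \<in> borel_measurable M"
      unfolding half_mean_def using measurable_source_algebra[OF measurable_pairs[of "{Pairs}"]]
      by (intro borel_measurable_divide borel_measurable_sum measurable_gap) auto
    ultimately have "(\<integral>\<^sup>+\<omega>. ennreal (half_mean N (spread_step \<sigma> (?h n) (gap N \<sigma> (\<lambda>i. p i \<omega>) ?y ?h n))) \<partial>M)
        = ennreal (post (1 - 2 / (real N * (real N - 1))) \<sigma> (emp_var N ?y) ?h n + \<sigma>\<^sup>2 * ?h n)"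
      using pairs_average_gap[OF N h, where y = ?y and n = n] h
      by (simp add: half_mean_spread_step[OF N] nn_integral_add emeasure_space_1)
    then show "(\<integral>\<^sup>+\<omega>. f (\<omega>', \<omega>) \<partial>M) = indicator (epoch_window t n) \<omega>' *
        ennreal (post (1 - 2 / (real N * (real N - 1))) \<sigma> (emp_var N ?y) ?h n + \<sigma>\<^sup>2 * ?h n)"
      by (auto simp: f_def indicator_def)
  qed
  finally show ?thesis by (simp add: f_def)
qed

text \<open>The third decoupling. By \<open>post_linear\<close> the initial configuration enters as
  a factor independent of the epochs, and in \<open>[0,\<infinity>]\<close> the resulting product
  makes sense for an infinite initial mean.\<close>

lemma window_initial_average:
  assumes N: "N \<ge> 2" and r: "0 \<le> r"
  shows "(\<integral>\<^sup>+\<omega>. indicator (epoch_window t n) \<omega> *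
        ennreal (post r \<sigma> (emp_var N (x 0 \<omega>)) (holding t \<omega>) n + \<sigma>\<^sup>2 * holding t \<omega> n) \<partial>M)
    = (\<integral>\<^sup>+\<omega>. indicator (epoch_window t n) \<omega> * ennreal (r ^ n) \<partial>M) * mean_emp_var M N x 0
     + (\<integral>\<^sup>+\<omega>. indicator (epoch_window t n) \<omega> * ennreal (post r \<sigma> 0 (holding t \<omega>) n + \<sigma>\<^sup>2 * holding t \<omega> n) \<partial>M)"
proof -
  let ?L = "source_algebra {Epochs} \<Otimes>\<^sub>M source_algebra {Initial}"
  define c where "c \<omega> = post r \<sigma> 0 (holding t \<omega>) n + \<sigma>\<^sup>2 * holding t \<omega> n" for \<omega>
  define f where "f = (\<lambda>(\<omega>', \<omega>). indicator (epoch_window t n) \<omega>' *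
     (ennreal (r ^ n) * ennreal (emp_var N (x 0 \<omega>)) + ennreal (c \<omega>')))"
  have c: "c \<in> borel_measurable (source_algebra {Epochs})"
    unfolding c_def by (intro borel_measurable_add borel_measurable_times borel_measurable_const
        measurable_post measurable_holding) auto
  have f: "f \<in> borel_measurable ?L"
    unfolding f_def split_def
    by (intro borel_measurable_times_ennreal measurable_compose[OF measurable_fst measurable_epoch_window]
        borel_measurable_add borel_measurable_const measurable_compose[OF _ measurable_ennreal]
        measurable_compose[OF measurable_fst c] measurable_emp_var measurable_compose[OF measurable_snd measurable_initial]) auto
  have v0: "0 \<le> emp_var N y" for y
    unfolding emp_var_eq_half_mean[OF N] by (rule half_mean_nonneg) (use N in auto)
  have [measurable]: "c \<in> borel_measurable M" by (rule measurable_source_algebra[OF c])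
  have [measurable]: "(indicator (epoch_window t n) :: 'a \<Rightarrow> ennreal) \<in> borel_measurable M"
    by (rule measurable_source_algebra[OF measurable_epoch_window[of "{Epochs}"]]) simp
  have V[measurable]: "(\<lambda>\<omega>. ennreal (emp_var N (x 0 \<omega>))) \<in> borel_measurable M"
    by (intro measurable_emp_var x_measurable) auto
  have "(\<integral>\<^sup>+\<omega>. indicator (epoch_window t n) \<omega> *
        ennreal (post r \<sigma> (emp_var N (x 0 \<omega>)) (holding t \<omega>) n + \<sigma>\<^sup>2 * holding t \<omega> n) \<partial>M) = (\<integral>\<^sup>+\<omega>. f (\<omega>, \<omega>) \<partial>M)"
  proof (rule nn_integral_cong_AE, use AE_epochs in eventually_elim)
    fix \<omega> assume \<tau>: "\<tau> 0 \<omega> = 0 \<and> (\<forall>n. \<tau> n \<omega> < \<tau> (Suc n) \<omega>)"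
    have h: "0 \<le> holding t \<omega> i" for i using \<tau> holding_nonneg by blast
    have "0 \<le> c \<omega>" unfolding c_def using r h by (intro add_nonneg_nonneg post_nonneg) auto
    then show "indicator (epoch_window t n) \<omega> *
        ennreal (post r \<sigma> (emp_var N (x 0 \<omega>)) (holding t \<omega>) n + \<sigma>\<^sup>2 * holding t \<omega> n) = f (\<omega>, \<omega>)"
      unfolding f_def post_linear[of r \<sigma> "emp_var N (x 0 \<omega>)"] using r v0
      by (simp add: c_def add.assoc ennreal_mult[symmetric] ennreal_plus[symmetric] del: ennreal_plus)
  qed
  also have "\<dots> = (\<integral>\<^sup>+\<omega>'. \<integral>\<^sup>+\<omega>. f (\<omega>', \<omega>) \<partial>M \<partial>M)"
    by (rule nn_integral_decouple[OF _ f]) simp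
  also have "\<dots> = (\<integral>\<^sup>+\<omega>'. indicator (epoch_window t n) \<omega>' * ennreal (r ^ n) * mean_emp_var M N x 0
      + indicator (epoch_window t n) \<omega>' * ennreal (c \<omega>') \<partial>M)"
    unfolding f_def mean_emp_var_def
    by (simp add: nn_integral_cmult nn_integral_add emeasure_space_1 distrib_left mult.assoc)
  also have "\<dots> = (\<integral>\<^sup>+\<omega>. indicator (epoch_window t n) \<omega> * ennreal (r ^ n) \<partial>M) * mean_emp_var M N x 0
     + (\<integral>\<^sup>+\<omega>. indicator (epoch_window t n) \<omega> * ennreal (c \<omega>) \<partial>M)"
    by (subst nn_integral_add, measurable) (subst nn_integral_multc, auto)
  finally show ?thesis unfolding c_def .
qed

text \<open>On the window of index \<open>n\<close> the first \<open>n\<close> stopped flights are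
  complete and flight \<open>n\<close> lasts \<open>t - \<tau> n \<omega>\<close>, which turns the
  series into that of \<open>renewal_sum\<close>. That some window occurs is the absence of
  accumulating epochs.\<close>

lemma window_sum:
  assumes \<delta>: "\<delta> > 0" and l: "l \<ge> 1" and v: "v \<ge> 0" and t: "t \<ge> 0"
  shows "(\<Sum>n. \<integral>\<^sup>+\<omega>. indicator (epoch_window t n) \<omega> *
      ennreal (post (1 - 1 / l) \<sigma> v (holding t \<omega>) n + \<sigma>\<^sup>2 * holding t \<omega> n) \<partial>M) = ennreal (relaxation \<sigma> \<delta> l v t)"
    and "AE \<omega> in M. \<exists>n. \<omega> \<in> epoch_window t n"
proof -
  define H where "H n \<omega> = \<tau> (Suc n) \<omega> - \<tau> n \<omega>" for n \<omega>
  have ind: "indep_vars (\<lambda>_. borel) H UNIV" and ex: "\<And>n. distributed M lborel (H n) (exponential_density \<delta>)"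
    using epochs unfolding poisson_epochs_def H_def by auto
  have nonneg: "AE \<omega> in M. \<forall>n. 0 \<le> H n \<omega>"
    using AE_epochs by eventually_elim (auto simp: H_def less_imp_le)
  have T: "AE \<omega> in M. \<forall>n. (\<Sum>i<n. H i \<omega>) = \<tau> n \<omega>"
    using AE_epochs by eventually_elim (simp add: H_def sum_lessThan_telescope[of "\<lambda>i. \<tau> i _"])
  have post_eq: "post (1 - 1 / l) \<sigma> v (holding t \<omega>) n + \<sigma>\<^sup>2 * holding t \<omega> n
      = post (1 - 1 / l) \<sigma> v (\<lambda>i. H i \<omega>) n + \<sigma>\<^sup>2 * (t - \<tau> n \<omega>)"
    if "\<forall>n. \<tau> n \<omega> < \<tau> (Suc n) \<omega>" "\<omega> \<in> epoch_window t n" for \<omega> n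
  proof -
    have w: "\<tau> n \<omega> \<le> t" "t < \<tau> (Suc n) \<omega>" using that by (auto simp: epoch_window_def)
    have mono: "\<tau> i \<omega> \<le> \<tau> n \<omega>" if "i \<le> n" for i
      using lift_Suc_mono_le[of "\<lambda>i. \<tau> i \<omega>", OF less_imp_le that] \<open>\<forall>n. \<tau> n \<omega> < \<tau> (Suc n) \<omega>\<close> by blast
    have "holding t \<omega> i = H i \<omega>" if "i < n" for i
      using mono[of i] mono[of "Suc i"] that w by (simp add: holding_def stopped_def H_def min_absorb1)
    then have "post (1 - 1 / l) \<sigma> v (holding t \<omega>) n = post (1 - 1 / l) \<sigma> v (\<lambda>i. H i \<omega>) n"
      by (rule post_cong)
    moreover have "holding t \<omega> n = t - \<tau> n \<omega>"
      using w by (simp add: holding_def stopped_def min_absorb1 min_absorb2)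
    ultimately show ?thesis by simp
  qed
  have "(\<integral>\<^sup>+\<omega>. indicator (epoch_window t n) \<omega> *
      ennreal (post (1 - 1 / l) \<sigma> v (holding t \<omega>) n + \<sigma>\<^sup>2 * holding t \<omega> n) \<partial>M)
    = (\<integral>\<^sup>+\<omega>. indicator {\<omega>. (\<Sum>i<n. H i \<omega>) \<le> t \<and> t < (\<Sum>i<Suc n. H i \<omega>)} \<omega> *
       ennreal (post (1 - 1 / l) \<sigma> v (\<lambda>i. H i \<omega>) n + \<sigma>\<^sup>2 * (t - (\<Sum>i<n. H i \<omega>))) \<partial>M)" for n
  proof (rule nn_integral_cong_AE, use AE_epochs T in eventually_elim)
    fix \<omega> assume \<tau>: "\<tau> 0 \<omega> = 0 \<and> (\<forall>n. \<tau> n \<omega> < \<tau> (Suc n) \<omega>)" and T: "\<forall>n. (\<Sum>i<n. H i \<omega>) = \<tau> n \<omega>"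
    have "\<omega> \<in> {\<omega>. (\<Sum>i<n. H i \<omega>) \<le> t \<and> t < (\<Sum>i<Suc n. H i \<omega>)} \<longleftrightarrow> \<omega> \<in> epoch_window t n"
      unfolding mem_Collect_eq T[rule_format] by (simp add: epoch_window_def)
    then show "indicator (epoch_window t n) \<omega> *
      ennreal (post (1 - 1 / l) \<sigma> v (holding t \<omega>) n + \<sigma>\<^sup>2 * holding t \<omega> n)
    = indicator {\<omega>. (\<Sum>i<n. H i \<omega>) \<le> t \<and> t < (\<Sum>i<Suc n. H i \<omega>)} \<omega> *
       ennreal (post (1 - 1 / l) \<sigma> v (\<lambda>i. H i \<omega>) n + \<sigma>\<^sup>2 * (t - (\<Sum>i<n. H i \<omega>)))"
      using post_eq[of \<omega> n] \<tau> unfolding T[rule_format] indicator_def by simp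
  qed
  then show "(\<Sum>n. \<integral>\<^sup>+\<omega>. indicator (epoch_window t n) \<omega> *
      ennreal (post (1 - 1 / l) \<sigma> v (holding t \<omega>) n + \<sigma>\<^sup>2 * holding t \<omega> n) \<partial>M) = ennreal (relaxation \<sigma> \<delta> l v t)"
    using renewal_sum[OF \<delta> l v t ind ex nonneg, of \<sigma>] by simp
  show "AE \<omega> in M. \<exists>n. \<omega> \<in> epoch_window t n"
    using exponential_sum_unbounded[OF \<delta> ind ex, of t] T AE_epochs
  proof eventually_elim
    fix \<omega> assume *: "\<exists>n. t < (\<Sum>i<n. H i \<omega>)" and T: "\<forall>n. (\<Sum>i<n. H i \<omega>) = \<tau> n \<omega>"
      and \<tau>: "\<tau> 0 \<omega> = 0 \<and> (\<forall>n. \<tau> n \<omega> < \<tau> (Suc n) \<omega>)"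
    \<comment> \<open>The first epoch beyond \<open>t\<close>; it is not epoch 0, which lies at time
      0, so the window starts at its predecessor.\<close>
    define m where "m = (LEAST n. t < \<tau> n \<omega>)"
    have m: "t < \<tau> m \<omega>" unfolding m_def by (rule LeastI_ex) (use * T in auto)
    then have "m \<noteq> 0" using \<tau> t by (metis not_less)
    then obtain n where n: "m = Suc n" by (cases m) auto
    have "\<not> t < \<tau> n \<omega>" using not_less_Least[of n "\<lambda>n. t < \<tau> n \<omega>"] n unfolding m_def by simp
    then have "\<omega> \<in> epoch_window t n" using m n by (simp add: epoch_window_def)
    then show "\<exists>n. \<omega> \<in> epoch_window t n" ..
  qed
qed

text \<open>\<open>window_sum\<close> covers finite deterministic initial values only. Its cases
  \<open>v = 0\<close> and \<open>v = 1\<close> determine the sums of \<open>D\<close> and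
  \<open>C\<close>, the constant and the coefficient of the initial mean, and these remain valid for
  an infinite one.\<close>

lemma mean_emp_var_relaxation:
  assumes N: "N \<ge> 2" and \<delta>: "\<delta> > 0" and t: "t \<ge> 0"
  defines "l \<equiv> real N * (real N - 1) / 2"
  shows "mean_emp_var M N x t = ennreal (\<sigma>\<^sup>2 / \<delta> * l * (1 - exp (- (\<delta> * t / l))))
         + ennreal (exp (- (\<delta> * t / l))) * mean_emp_var M N x 0"
proof -
  have "2 * 1 \<le> real N * (real N - 1)" using N by (intro mult_mono) auto
  then have l: "l \<ge> 1" by (simp add: l_def)
  define r where "r = 1 - 1 / l"
  have r: "0 \<le> r" "r = 1 - 2 / (real N * (real N - 1))" using l by (auto simp: r_def l_def)
  define C where "C n = (\<integral>\<^sup>+\<omega>. indicator (epoch_window t n) \<omega> * ennreal (r ^ n) \<partial>M)" for n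
  define D where "D n = (\<integral>\<^sup>+\<omega>. indicator (epoch_window t n) \<omega> *
      ennreal (post r \<sigma> 0 (holding t \<omega>) n + \<sigma>\<^sup>2 * holding t \<omega> n) \<partial>M)" for n
  have wm[measurable]: "(indicator (epoch_window t n) :: 'a \<Rightarrow> ennreal) \<in> borel_measurable M" for n
    by (rule measurable_source_algebra[OF measurable_epoch_window[of "{Epochs}"]]) simp
  have hm[measurable]: "(\<lambda>\<omega>. holding t \<omega> i) \<in> borel_measurable M" for i
    by (rule measurable_source_algebra[OF measurable_holding[of "{Epochs}"]]) simp
  have pm[measurable]: "(\<lambda>\<omega>. post r \<sigma> v (holding t \<omega>) n) \<in> borel_measurable M" for v n
    by (intro measurable_post) auto
  have Vm[measurable]: "(\<lambda>\<omega>. ennreal (emp_var N (x t \<omega>))) \<in> borel_measurable M"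
    by (intro measurable_emp_var x_measurable t)
  have sumD: "(\<Sum>n. D n) = ennreal (relaxation \<sigma> \<delta> l 0 t)"
    using window_sum(1)[OF \<delta> l order_refl t] unfolding D_def r_def .
  have CD: "C n + D n = (\<integral>\<^sup>+\<omega>. indicator (epoch_window t n) \<omega> *
      ennreal (post r \<sigma> 1 (holding t \<omega>) n + \<sigma>\<^sup>2 * holding t \<omega> n) \<partial>M)" for n
  proof -
    have "C n + D n = (\<integral>\<^sup>+\<omega>. indicator (epoch_window t n) \<omega> * ennreal (r ^ n) +
        indicator (epoch_window t n) \<omega> * ennreal (post r \<sigma> 0 (holding t \<omega>) n + \<sigma>\<^sup>2 * holding t \<omega> n) \<partial>M)"
      unfolding C_def D_def by (rule nn_integral_add[symmetric]) measurable
    also have "\<dots> = (\<integral>\<^sup>+\<omega>. indicator (epoch_window t n) \<omega> *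
      ennreal (post r \<sigma> 1 (holding t \<omega>) n + \<sigma>\<^sup>2 * holding t \<omega> n) \<partial>M)"
    proof (rule nn_integral_cong_AE, use AE_epochs in eventually_elim)
      fix \<omega> assume \<tau>: "\<tau> 0 \<omega> = 0 \<and> (\<forall>n. \<tau> n \<omega> < \<tau> (Suc n) \<omega>)"
      have h: "0 \<le> holding t \<omega> i" for i using \<tau> holding_nonneg by blast
      have "0 \<le> post r \<sigma> 0 (holding t \<omega>) n + \<sigma>\<^sup>2 * holding t \<omega> n"
        using r h by (intro add_nonneg_nonneg post_nonneg) auto
      then show "indicator (epoch_window t n) \<omega> * ennreal (r ^ n) +
        indicator (epoch_window t n) \<omega> * ennreal (post r \<sigma> 0 (holding t \<omega>) n + \<sigma>\<^sup>2 * holding t \<omega> n)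
        = indicator (epoch_window t n) \<omega> * ennreal (post r \<sigma> 1 (holding t \<omega>) n + \<sigma>\<^sup>2 * holding t \<omega> n)"
        unfolding post_linear[of r \<sigma> 1] using r
        by (simp add: distrib_left[symmetric] add.assoc ennreal_plus[symmetric] del: ennreal_plus)
    qed
    finally show ?thesis .
  qed
  have "(\<Sum>n. C n) + (\<Sum>n. D n) = (\<Sum>n. C n + D n)" by (rule suminf_add) auto
  also have "\<dots> = ennreal (relaxation \<sigma> \<delta> l 1 t)"
    unfolding CD using window_sum(1)[OF \<delta> l zero_le_one t] unfolding r_def .
  also have "\<dots> = ennreal (exp (- (\<delta> * t / l))) + ennreal (relaxation \<sigma> \<delta> l 0 t)"
    using relaxation_nonneg[of \<delta> l 0 t \<sigma>] \<delta> l t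
    by (subst ennreal_plus[symmetric]) (auto simp: relaxation_def)
  \<comment> \<open>Cancellation in \<open>[0,\<infinity>]\<close> is legitimate because the common
    summand is finite.\<close>
  finally have sumC: "(\<Sum>n. C n) = ennreal (exp (- (\<delta> * t / l)))"
    unfolding sumD by (simp add: add.commute[of _ "ennreal (relaxation \<sigma> \<delta> l 0 t)"] ennreal_add_left_cancel)
  have "mean_emp_var M N x t = (\<integral>\<^sup>+\<omega>. (\<Sum>n. indicator (epoch_window t n) \<omega> * ennreal (emp_var N (x t \<omega>))) \<partial>M)"
    unfolding mean_emp_var_def
  proof (rule nn_integral_cong_AE, use window_sum(2)[OF \<delta> l order_refl t] AE_epochs in eventually_elim)
    fix \<omega> assume "\<exists>n. \<omega> \<in> epoch_window t n" and \<tau>: "\<tau> 0 \<omega> = 0 \<and> (\<forall>n. \<tau> n \<omega> < \<tau> (Suc n) \<omega>)"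
    then obtain n where n: "\<omega> \<in> epoch_window t n" by blast
    have mono: "\<tau> i \<omega> \<le> \<tau> j \<omega>" if "i \<le> j" for i j
      using lift_Suc_mono_le[of "\<lambda>i. \<tau> i \<omega>", OF less_imp_le that] \<tau> by blast
    have "\<omega> \<notin> epoch_window t m" if "m \<noteq> n" for m
      using mono[of "Suc m" n] mono[of "Suc n" m] n that
      by (cases m n rule: linorder_cases) (auto simp: epoch_window_def)
    then have "(\<Sum>m. indicator (epoch_window t m) \<omega> * ennreal (emp_var N (x t \<omega>)))
       = (\<Sum>m\<in>{n}. indicator (epoch_window t m) \<omega> * ennreal (emp_var N (x t \<omega>)))"
      by (intro suminf_finite) auto
    then show "ennreal (emp_var N (x t \<omega>)) = (\<Sum>m. indicator (epoch_window t m) \<omega> * ennreal (emp_var N (x t \<omega>)))"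
      using n by simp
  qed
  also have "\<dots> = (\<Sum>n. \<integral>\<^sup>+\<omega>. indicator (epoch_window t n) \<omega> * ennreal (emp_var N (x t \<omega>)) \<partial>M)"
    by (rule nn_integral_suminf) measurable
  also have "\<dots> = (\<Sum>n. C n * mean_emp_var M N x 0 + D n)"
    unfolding window_noise_average[OF N t] window_pairs_average[OF N t] r(2)[symmetric]
      window_initial_average[OF N r(1)] C_def D_def ..
  also have "\<dots> = (\<Sum>n. C n) * mean_emp_var M N x 0 + (\<Sum>n. D n)"
    by (subst suminf_add[symmetric]) auto
  finally show ?thesis
    unfolding sumC sumD by (simp add: relaxation_def add.commute)
qed

end

theorem theorem3:
  fixes \<sigma> \<delta> :: real
  assumes "\<sigma> > 0" and "\<delta> > 0"
  shows "\<exists>\<kappa>::real. \<kappa> > 0 \<and> (\<forall>N\<ge>2. \<forall>(M :: 'a measure) B \<tau> p x.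
    synchronizing_particles M N \<sigma> \<delta> B \<tau> p x \<longrightarrow>
    (\<forall>t\<ge>0. let l = real N * (real N - 1) / \<kappa> in
       mean_emp_var M N x t =
         ennreal (\<sigma>\<^sup>2 / \<delta> * l * (1 - exp (- (\<delta> * t / l))))
         + ennreal (exp (- (\<delta> * t / l))) * mean_emp_var M N x 0))"
  unfolding Let_def
  using synchronizing_particles.mean_emp_var_relaxation[OF _ _ \<open>\<delta> > 0\<close>]
  by (intro exI[of _ 2] conjI allI impI) simp_all

end
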